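(* Let $d \in \mathbb{N}$. Every graph $G$ admits a tree-decomposition $(T, (V_t : t \in V(T)))$ such that: (i) every adhesion set has intrinsic diameter at most $15d+8$, (ii) every outer-torso is a $(d,7d+4)$-inseparable graph, and (iii) for every bag $V_t$, the identity $\mathrm{Id}: G[V_t] \to G$ has additive distortion at most $20d+12$.
   Context: Distances: for a graph $G$, $d_G(u,v)$ is the distance of the vertices $u,v$ in $G$. For $U,U' \subseteq V(G)$, $d_G(U,U')$ is the minimum distance in $G$ between an element of $U$ and an element of $U'$. The diameter of $U \subseteq V(G)$ in $G$ is the smallest $k \in \mathbb{N}\cup\{\infty\}$ such that $d_G(u,v)\le k$ for all $u,v \in U$. The intrinsic diameter of $U$ is the smallest $k \in \mathbb{N}\cup\{\infty\}$ such that $d_{G[U]}(u,v) \le k$ for all $u,v \in U$, where $G[U]$ is the subgraph of $G$ induced by $U$. Inseparability: for $d, D \in \mathbb{N}$, a vertex set $U \subseteq V(G)$ is $(d,D)$-inseparable in $G$ if for every set $S \subseteq V(G)$ of diameter at most $d$ in $G$ and every two vertices $u,v \in U$, either one of $u,v$ has distance at most $D$ from $S$ in $G$, or $u,v$ lie in the same component of $G-S$. A graph $G$ is $(d,D)$-inseparable if $V(G)$ is $(d,D)$-inseparable in $G$. Additive distortion: for graphs $G, H$, a map $\varphi: V(G)\to V(H)$ has additive distortion at most $D \in \mathbb{N}$ if $d_G(u,v)-D \le d_H(\varphi(u),\varphi(v)) \le d_G(u,v)+D$ for all $u,v \in V(G)$. Tree-decompositions: a tree-decomposition of a graph $G$ is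 a pair $(T,(V_t : t \in V(T)))$, where $T$ is a tree and $V_t \subseteq V(G)$ for each $t \in V(T)$, such that: (T1) $V(G)=\bigcup_{t \in V(T)} V_t$; (T2) for every edge $uv$ of $G$ there is $t \in V(T)$ with $u,v \in V_t$; (T3) for all $t_1,t_2,t_3 \in V(T)$, if $t_2$ lies on the path of $T$ between $t_1$ and $t_3$, then $V_{t_1}\cap V_{t_3} \subseteq V_{t_2}$. The sets $V_t$ are the bags, and the sets $V_e := V_s \cap V_t$ for edges $e = st$ of $T$ are the adhesion sets. The outer-torso $O_t$ of a bag $V_t$ is the graph obtained from $G$ by contracting each component of $G-V_t$ into a vertex.
   Formalization: The graph G is assumed to be connected: if G is disconnected, every outer-torso is disconnected too, and the empty set S (diameter 0, infinitely far from every vertex) shows that it is not inseparable, so (ii) fails. *)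

theory Defs
  imports Main "HOL-Library.Extended_Nat" "HOL-Library.FuncSet"
begin

text \<open>
  Graphs are simple and may be infinite. An undirected edge \<open>uv\<close> is represented by the two pairs
  \<open>(u,v)\<close> and \<open>(v,u)\<close>, so that walks, reachability and distance are powers and reflexive
  transitive closure of the relation \<open>adj\<close>.
\<close>

record 'a ugraph =
  verts :: "'a set"
  adj :: "('a \<times> 'a) set"

definition simple_graph :: "'a ugraph \<Rightarrow> bool" where
  "simple_graph G \<longleftrightarrow> adj G \<subseteq> verts G \<times> verts G \<and> sym (adj G) \<and> irrefl (adj G)"

definition induced :: "'a ugraph \<Rightarrow> 'a set \<Rightarrow> 'a ugraph" where
  "induced G U = \<lparr>verts = verts G \<inter> U, adj = adj G \<inter> U \<times> U\<rparr>"

definition delete :: "'a ugraph \<Rightarrow> 'a set \<Rightarrow> 'a ugraph" where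
  "delete G S = induced G (verts G - S)"

definition connected_graph :: "'a ugraph \<Rightarrow> bool" where
  "connected_graph G \<longleftrightarrow> (\<forall>u\<in>verts G. \<forall>v\<in>verts G. (u, v) \<in> (adj G)\<^sup>*)"

definition components :: "'a ugraph \<Rightarrow> 'a set set" where
  "components G = {C. \<exists>u\<in>verts G. C = {v. (u, v) \<in> (adj G)\<^sup>*}}"


subsection \<open>Distances and diameters\<close>

text \<open>The distance is the length of a shortest walk, and \<open>\<infinity>\<close> (the infimum of the empty set) if
  there is none.\<close>

definition gdist :: "'a ugraph \<Rightarrow> 'a \<Rightarrow> 'a \<Rightarrow> enat" where
  "gdist G u v = (INF n\<in>{n. (u, v) \<in> adj G ^^ n}. enat n)"

definition gdist_sets :: "'a ugraph \<Rightarrow> 'a set \<Rightarrow> 'a set \<Rightarrow> enat" where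
  "gdist_sets G U U' = (INF u\<in>U. INF v\<in>U'. gdist G u v)"

definition diam :: "'a ugraph \<Rightarrow> 'a set \<Rightarrow> enat" where
  "diam G U = (LEAST k. \<forall>u\<in>U. \<forall>v\<in>U. gdist G u v \<le> k)"

definition intrinsic_diam :: "'a ugraph \<Rightarrow> 'a set \<Rightarrow> enat" where
  "intrinsic_diam G U = (LEAST k. \<forall>u\<in>U. \<forall>v\<in>U. gdist (induced G U) u v \<le> k)"


subsection \<open>Inseparability\<close>

definition inseparable_in :: "nat \<Rightarrow> nat \<Rightarrow> 'a ugraph \<Rightarrow> 'a set \<Rightarrow> bool" where
  "inseparable_in d D G U \<longleftrightarrow>
     (\<forall>S. S \<subseteq> verts G \<and> diam G S \<le> enat d \<longrightarrow>
       (\<forall>u\<in>U. \<forall>v\<in>U.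
          gdist_sets G {u} S \<le> enat D \<or> gdist_sets G {v} S \<le> enat D \<or>
          (\<exists>C\<in>components (delete G S). u \<in> C \<and> v \<in> C)))"

definition inseparable_graph :: "nat \<Rightarrow> nat \<Rightarrow> 'a ugraph \<Rightarrow> bool" where
  "inseparable_graph d D G \<longleftrightarrow> inseparable_in d D G (verts G)"


subsection \<open>Additive distortion\<close>

text \<open>Subtraction on \<^typ>\<open>enat\<close> is truncated at \<open>0\<close>, which is harmless here since distances are
  nonnegative; moreover \<open>\<infinity> - D = \<infinity>\<close>.\<close>

definition additive_distortion_le ::
    "nat \<Rightarrow> 'a ugraph \<Rightarrow> 'b ugraph \<Rightarrow> ('a \<Rightarrow> 'b) \<Rightarrow> bool" where
  "additive_distortion_le D G H f \<longleftrightarrow> f \<in> verts G \<rightarrow> verts H \<and>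
     (\<forall>u\<in>verts G. \<forall>v\<in>verts G.
        gdist G u v - enat D \<le> gdist H (f u) (f v) \<and>
        gdist H (f u) (f v) \<le> gdist G u v + enat D)"


subsection \<open>Trees and tree-decompositions\<close>

definition path_in :: "'a ugraph \<Rightarrow> 'a list \<Rightarrow> bool" where
  "path_in G p \<longleftrightarrow> p \<noteq> [] \<and> distinct p \<and> set p \<subseteq> verts G \<and>
     successively (\<lambda>u v. (u, v) \<in> adj G) p"

definition acyclic_graph :: "'a ugraph \<Rightarrow> bool" where
  "acyclic_graph G \<longleftrightarrow> \<not> (\<exists>p. path_in G p \<and> length p \<ge> 3 \<and> (last p, hd p) \<in> adj G)"

definition tree :: "'a ugraph \<Rightarrow> bool" where
  "tree T \<longleftrightarrow> simple_graph T \<and> verts T \<noteq> {} \<and> connected_graph T \<and> acyclic_graph T"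

text \<open>The nodes of the tree have an arbitrary type \<open>'t\<close>. Any infinite type at least as large as
  \<open>'a\<close> suffices for an existence statement about bags: restricting a tree-decomposition to the
  subtree spanned by one suitable node per vertex and edge of \<open>G\<close> (and at least one node) yields
  again a tree-decomposition, with a subset of the old bags and adhesion sets.\<close>

definition tree_decomposition :: "'a ugraph \<Rightarrow> 't ugraph \<Rightarrow> ('t \<Rightarrow> 'a set) \<Rightarrow> bool" where
  "tree_decomposition G T V \<longleftrightarrow>
     tree T \<and>
     (\<forall>t\<in>verts T. V t \<subseteq> verts G) \<and>
     verts G = (\<Union>t\<in>verts T. V t) \<and>
     (\<forall>(u, v)\<in>adj G. \<exists>t\<in>verts T. u \<in> V t \<and> v \<in> V t) \<and>
     (\<forall>p. path_in T p \<longrightarrow> (\<forall>t\<in>set p. V (hd p) \<inter> V (last p) \<subseteq> V t))"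


subsection \<open>Outer-torsos\<close>

text \<open>The vertices of a contraction are represented by their branch sets: a vertex \<open>v\<close> of the bag
  becomes \<open>{v}\<close>, and every component of \<open>G - U\<close> becomes a single vertex.\<close>

definition outer_torso :: "'a ugraph \<Rightarrow> 'a set \<Rightarrow> 'a set ugraph" where
  "outer_torso G U =
     (let W = (\<lambda>v. {v}) ` U \<union> components (delete G U)
      in \<lparr>verts = W,
          adj = {(X, Y). X \<in> W \<and> Y \<in> W \<and> X \<noteq> Y \<and> (\<exists>x\<in>X. \<exists>y\<in>Y. (x, y) \<in> adj G)}\<rparr>)"

text \<open>An outer-torso of a disconnected graph is disconnected, so the empty separator shows that it
  is never inseparable. Hence a decomposition into inseparable outer-torsos is only possible for
  connected graphs.\<close>

lemma connected_if_outer_torso_inseparable: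
  assumes G: "simple_graph G" and U: "U \<subseteq> verts G"
    and ins: "inseparable_graph d D (outer_torso G U)"
  shows "connected_graph G"
  unfolding connected_graph_def
proof (intro ballI)
  fix a b assume ab: "a \<in> verts G" "b \<in> verts G"
  let ?O = "outer_torso G U" and ?R = "(adj G)\<^sup>*"
  let ?f = "\<lambda>v. if v \<in> U then {v} else {y. (v, y) \<in> (adj (delete G U))\<^sup>*}"
  have symR: "sym ?R"
    using G by (simp add: simple_graph_def sym_rtrancl)
  have sub: "(adj (delete G U))\<^sup>* \<subseteq> ?R"
    by (rule rtrancl_mono) (auto simp: delete_def induced_def)
  have conn: "(x, y) \<in> ?R" if "X \<in> verts ?O" "x \<in> X" "y \<in> X" for X x y
    using that sub symR
    by (auto simp: outer_torso_def Let_def components_def)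
      (meson rtrancl_trans subsetD symD)
  have f: "?f v \<in> verts ?O" "v \<in> ?f v" if "v \<in> verts G" for v
    using that by (auto simp: outer_torso_def Let_def components_def delete_def induced_def)
  have edge: "(x, y) \<in> ?R" if "(X, Y) \<in> adj ?O" "x \<in> X" "y \<in> Y" for X Y x y
  proof -
    from that(1) obtain x' y' where *: "X \<in> verts ?O" "Y \<in> verts ?O" "x' \<in> X" "y' \<in> Y"
        "(x', y') \<in> adj G"
      by (auto simp: outer_torso_def Let_def)
    show ?thesis
      using conn[OF *(1) that(2) *(3)] *(5) conn[OF *(2) *(4) that(3)] by auto
  qed
  have ne: "\<exists>x. x \<in> X" if "X \<in> verts ?O" for X
    using that by (auto simp: outer_torso_def Let_def components_def)
  have reach: "\<forall>x\<in>X. \<forall>y\<in>Y. (x, y) \<in> ?R" if "(X, Y) \<in> (adj ?O)\<^sup>*" "X \<in> verts ?O" for X Y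
    using that(1)
  proof (induction rule: rtrancl_induct)
    case base
    then show ?case using conn that(2) by blast
  next
    case (step Y Z)
    then have "Y \<in> verts ?O" by (auto simp: outer_torso_def Let_def)
    with ne obtain y where "y \<in> Y" by blast
    with step edge[OF step(2)] show ?case
      by (meson rtrancl_trans)
  qed
  have "diam ?O {} \<le> enat d"
    unfolding diam_def by (rule Least_le) simp
  moreover have "\<not> gdist_sets ?O {X} {} \<le> enat D" for X
    by (simp add: gdist_sets_def top_enat_def)
  ultimately have "\<exists>C\<in>components (delete ?O {}). ?f a \<in> C \<and> ?f b \<in> C"
    using ins[unfolded inseparable_graph_def inseparable_in_def, rule_format, of "{}" "?f a" "?f b"]
      f(1)[OF ab(1)] f(1)[OF ab(2)] by blast
  then obtain Z where Z': "Z \<in> verts (delete ?O {})"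
      "(Z, ?f a) \<in> (adj (delete ?O {}))\<^sup>*" "(Z, ?f b) \<in> (adj (delete ?O {}))\<^sup>*"
    unfolding components_def by blast
  have "(adj (delete ?O {}))\<^sup>* \<subseteq> (adj ?O)\<^sup>*"
    by (rule rtrancl_mono) (auto simp: delete_def induced_def)
  moreover have "Z \<in> verts ?O"
    using Z'(1) by (simp add: delete_def induced_def)
  ultimately have Z: "Z \<in> verts ?O" "(Z, ?f a) \<in> (adj ?O)\<^sup>*" "(Z, ?f b) \<in> (adj ?O)\<^sup>*"
    using Z'(2,3) by blast+
  obtain z where "z \<in> Z" using ne Z(1) by blast
  then have "(z, a) \<in> ?R" "(z, b) \<in> ?R"
    using reach[OF Z(2,1)] reach[OF Z(3,1)] f(2) ab by blast+
  then show "(a, b) \<in> ?R"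
    using symR by (meson rtrancl_trans symD)
qed

end

theory Submission
  imports Defs
begin

text \<open>
  The decomposition comes from a rooted laminar family. Level \<open>0\<close> consists of \<open>V(G)\<close> only, and level
  \<open>n + 1\<close> consists of certain components of \<open>A - X\<close>, for every set \<open>A\<close> of level \<open>n\<close> and a cut set
  \<open>X\<close> that depends on \<open>A\<close>. Write \<open>N(A)\<close> for the set of vertices outside \<open>A\<close> that have a neighbour
  in \<open>A\<close>. The tree has a node for each set of each level, joined to its children in the next level.
  The bag of \<open>A\<close> consists of its core (the vertices of \<open>A \<union> N(A)\<close> that lie in no child) and of the balls
  of radius \<open>r = 4d + 2\<close> around \<open>N(A)\<close> and around \<open>N(B)\<close> for every child \<open>B\<close>.

  Whatever the cut sets are, (i) and (iii) follow as soon as every \<open>N(A)\<close> has diameter at most \<open>r\<close>.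
  The adhesion set of the edge between \<open>A\<close> and its child \<open>B\<close> is exactly the ball of radius \<open>r\<close> around
  \<open>N(B)\<close>, so its intrinsic diameter is at most \<open>3r\<close>. A geodesic between two core vertices that left
  the bag would cross some boundary \<open>N(B)\<close>, go to distance more than \<open>r\<close> from it and come back to
  it, which is longer than a shortest path between the two crossing points. Hence core vertices have
  the same distance in the bag as in \<open>G\<close>, and any other vertex of the bag reaches within \<open>2r\<close> a boundary
  vertex on the geodesic in question, unless both ends are near the same boundary and thus at distance
  at most \<open>3r\<close> in the bag. This gives additive distortion at most \<open>4r\<close>.

  It remains to choose the cut sets such that all outer-torsos are inseparable. Every \<open>A\<close> is
  controlled by an anchor \<open>Z\<close>, a set of diameter at most \<open>d\<close>, and odd and even levels alternate.
  Let \<open>p = d + \<lfloor>d/2\<rfloor> + 1\<close>.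

  At an odd level, \<open>A\<close> avoids the ball of radius \<open>p\<close> around \<open>Z\<close> while \<open>N(A)\<close> lies in that ball.
  Call a connected set \<open>C\<close> disjoint from \<open>Z\<close> a lobe if \<open>N(C)\<close> has diameter at most \<open>d\<close> and is at
  distance more than \<open>d/2\<close> from \<open>Z\<close>. By Zorn's lemma every lobe lies in a maximal one. If
  \<open>C\<close> and \<open>C'\<close> are maximal lobes, then every vertex of \<open>N(C') \<inter> C\<close> is within distance \<open>d\<close> of
  \<open>N(C)\<close>, for otherwise \<open>N(C') \<subseteq> C\<close> and \<open>C \<union> C'\<close> would be a larger lobe
  (\<open>max_lobe_cross\<close>). The cut set is the union of the boundaries of all maximal lobes, and the children
  are the components inside lobes; the boundary of a child is therefore within \<open>d\<close> of
  the boundary of any maximal lobe around the child. Suppose that a set \<open>S\<close> of diameter at most \<open>d\<close> separates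
  two far away vertices in the torso. Because of the thick balls around the boundaries, \<open>S\<close> either
  lies deep beyond a single boundary, where it cannot separate much, or is a set of diameter at most \<open>d\<close> in
  \<open>G\<close>. In the latter case, if \<open>S\<close> comes within \<open>d/2\<close> of \<open>Z\<close>, then it lies in the ball around \<open>Z\<close> and
  misses the connected set \<open>A\<close>, which joins everything. Otherwise \<open>Z\<close> lies in one component of
  \<open>G - S\<close>, so \<open>S\<close> cuts one of the two vertices off from \<open>Z\<close>. Its component is a lobe and lies in a
  maximal lobe, but from every vertex of the bag one can leave a given maximal lobe within
  \<open>r + d\<close> steps (\<open>leave_max_lobe\<close>), so \<open>S\<close> is close to that vertex after all.

  At an even level, \<open>A\<close> is such a child, and its anchor is the boundary of a maximal lobe around it, so
  \<open>N(A)\<close> is within \<open>d\<close> of \<open>Z\<close>. The cut set is the ball of radius \<open>p\<close> around \<open>Z\<close>. The bag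
  is so small that a separator near \<open>Z\<close> is near everything, while any other one leaves \<open>Z\<close> and the
  vertices far from the separator in one component; and the children have the form needed at the next odd
  level. These intermediate bags absorb the separators that cross \<open>N(A)\<close>; without them the diameters of the
  boundaries would grow from level to level. At level \<open>0\<close>, where \<open>N(A)\<close> is empty, the anchor is arbitrary.
\<close>

section \<open>Walks, balls, boundaries and components\<close>

text \<open>Distances are handled through the relation ``at distance at most \<open>k\<close>'', which stays
  within relation powers and thus avoids arithmetic with infinite distances.\<close>

definition near :: "('a \<times> 'a) set \<Rightarrow> nat \<Rightarrow> 'a \<Rightarrow> 'a \<Rightarrow> bool" where
  "near E k u v \<longleftrightarrow> (\<exists>j\<le>k. (u, v) \<in> E ^^ j)"

definition ball :: "('a \<times> 'a) set \<Rightarrow> 'a set \<Rightarrow> nat \<Rightarrow> 'a set" where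
  "ball E S k = {v. \<exists>s\<in>S. near E k s v}"

definition diam_le :: "('a \<times> 'a) set \<Rightarrow> nat \<Rightarrow> 'a set \<Rightarrow> bool" where
  "diam_le E k S \<longleftrightarrow> (\<forall>u\<in>S. \<forall>v\<in>S. near E k u v)"

definition nbr :: "('a \<times> 'a) set \<Rightarrow> 'a set \<Rightarrow> 'a set" where
  "nbr E A = E `` A - A"

abbreviation restr :: "('a \<times> 'a) set \<Rightarrow> 'a set \<Rightarrow> ('a \<times> 'a) set" where
  "restr E U \<equiv> E \<inter> U \<times> U"

definition conn :: "('a \<times> 'a) set \<Rightarrow> 'a set \<Rightarrow> bool" where
  "conn E A \<longleftrightarrow> (\<forall>u\<in>A. \<forall>v\<in>A. (u, v) \<in> (restr E A)\<^sup>*)"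

definition comps :: "('a \<times> 'a) set \<Rightarrow> 'a set \<Rightarrow> 'a set set" where
  "comps E U = {C. \<exists>u\<in>U. C = {v. (u, v) \<in> (restr E U)\<^sup>*}}"

lemma near_refl [simp]: "near E k u u"
  unfolding near_def by (rule exI[of _ 0]) simp

lemma near_mono: "near E k u v \<Longrightarrow> k \<le> l \<Longrightarrow> near E l u v"
  unfolding near_def by (meson order_trans)

lemma near_trans: "near E k u v \<Longrightarrow> near E l v w \<Longrightarrow> near E (k + l) u w"
proof -
  assume "near E k u v" "near E l v w"
  then obtain i j where "i \<le> k" "j \<le> l" "(u, v) \<in> E ^^ i" "(v, w) \<in> E ^^ j"
    unfolding near_def by blast
  then have "i + j \<le> k + l" "(u, w) \<in> E ^^ (i + j)" by (auto simp: relpow_add)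
  then show ?thesis unfolding near_def by blast
qed

lemma near_edge: "(u, v) \<in> E \<Longrightarrow> near E (Suc 0) u v"
  unfolding near_def by (rule exI[of _ "Suc 0"]) simp

lemma near_relpow: "(u, v) \<in> E ^^ k \<Longrightarrow> near E k u v"
  unfolding near_def by auto

lemma relpow_sym: "sym E \<Longrightarrow> (u, v) \<in> E ^^ k \<Longrightarrow> (v, u) \<in> E ^^ k"
proof (induction k arbitrary: v)
  case (Suc k)
  then obtain w where "(u, w) \<in> E ^^ k" "(w, v) \<in> E" by auto
  with Suc have "(w, u) \<in> E ^^ k" "(v, w) \<in> E" by (auto dest: symD)
  then show ?case by (metis relpow_Suc_I2)
qed auto

lemma near_sym: "sym E \<Longrightarrow> near E k u v \<Longrightarrow> near E k v u"
  unfolding near_def using relpow_sym by metis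

lemma gdist_le_iff: "gdist G u v \<le> enat k \<longleftrightarrow> near (adj G) k u v"
proof
  let ?S = "enat ` {n. (u, v) \<in> adj G ^^ n}"
  assume le: "gdist G u v \<le> enat k"
  then have "?S \<noteq> {}"
    unfolding gdist_def Inf_enat_def by (auto split: if_splits)
  then have "Inf ?S \<in> ?S"
    unfolding Inf_enat_def by (auto intro: LeastI)
  then show "near (adj G) k u v"
    using le unfolding gdist_def near_def by auto
next
  assume "near (adj G) k u v"
  then obtain j where "j \<le> k" "(u, v) \<in> adj G ^^ j" unfolding near_def by blast
  then have "gdist G u v \<le> enat j" unfolding gdist_def by (auto intro: INF_lower)
  with \<open>j \<le> k\<close> show "gdist G u v \<le> enat k" by (meson enat_ord_simps(1) order_trans)
qed

text \<open>A restriction principle for geodesics: to keep a walk inside \<open>U\<close> it suffices to bound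
  the position of a vertex by its distances from both ends.\<close>

lemma relpow_inside:
  assumes "(u, v) \<in> E ^^ k"
    and "\<And>i j w. i + j = k \<Longrightarrow> (u, w) \<in> E ^^ i \<Longrightarrow> (w, v) \<in> E ^^ j \<Longrightarrow> w \<in> U"
  shows "(u, v) \<in> restr E U ^^ k"
  using assms
proof (induction k arbitrary: v)
  case (Suc k)
  then obtain w where w: "(u, w) \<in> E ^^ k" "(w, v) \<in> E" by auto
  have "(u, w) \<in> restr E U ^^ k"
  proof (rule Suc.IH[OF w(1)])
    fix i j x assume "i + j = k" "(u, x) \<in> E ^^ i" "(x, w) \<in> E ^^ j"
    then show "x \<in> U" using Suc.prems(2)[of i "Suc j" x] w(2) by auto
  qed
  moreover have "w \<in> U" using Suc.prems(2)[of k "Suc 0" w] w by auto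
  moreover have "v \<in> U" using Suc.prems(2)[of "Suc k" 0 v] Suc.prems(1) by auto
  ultimately show ?case using w(2) by auto
qed auto

lemma near_inside:
  assumes "near E k u v"
    and "\<And>i j w. i + j \<le> k \<Longrightarrow> near E i u w \<Longrightarrow> near E j w v \<Longrightarrow> w \<in> U"
  shows "near (restr E U) k u v"
proof -
  obtain l where l: "l \<le> k" "(u, v) \<in> E ^^ l" using assms(1) unfolding near_def by blast
  have "(u, v) \<in> restr E U ^^ l"
    by (rule relpow_inside[OF l(2)]) (use assms(2) l(1) near_relpow in metis)
  with l(1) show ?thesis unfolding near_def by blast
qed

lemma near_imp_rtrancl: "near E k u v \<Longrightarrow> (u, v) \<in> E\<^sup>*"
  unfolding near_def using relpow_imp_rtrancl by blast

text \<open>Every walk out of \<open>A\<close> passes through the boundary of \<open>A\<close> after at least one step; the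
  strictness is what makes the depth argument for the layered family terminate.\<close>

lemma near_exit:
  assumes "near E k u v" "u \<in> A" "v \<notin> A"
  obtains w i j where "w \<in> nbr E A" "Suc i + j \<le> k" "near E (Suc i) u w" "near E j w v"
proof -
  obtain l where l: "l \<le> k" "(u, v) \<in> E ^^ l" using assms(1) unfolding near_def by blast
  have "\<exists>w i j. w \<in> nbr E A \<and> Suc i + j = l \<and> (u, w) \<in> E ^^ Suc i \<and> (w, v) \<in> E ^^ j"
    using l(2) assms(3)
  proof (induction l arbitrary: v)
    case 0
    with assms(2) show ?case by simp
  next
    case (Suc l)
    then obtain w where w: "(u, w) \<in> E ^^ l" "(w, v) \<in> E" by auto
    show ?case
    proof (cases "w \<in> A")
      case True
      then have "v \<in> nbr E A" using w Suc.prems unfolding nbr_def by blast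
      then show ?thesis using Suc.prems(1) by (intro exI[of _ v] exI[of _ l] exI[of _ 0]) simp
    next
      case False
      then obtain x i j where "x \<in> nbr E A" "Suc i + j = l" "(u, x) \<in> E ^^ Suc i" "(x, w) \<in> E ^^ j"
        using Suc.IH w(1) by blast
      with w(2) show ?thesis
        by (intro exI[of _ x] exI[of _ i] exI[of _ "Suc j"]) auto
    qed
  qed
  then show thesis using that l(1) near_relpow by metis
qed

lemma in_ballI: "s \<in> S \<Longrightarrow> near E k s v \<Longrightarrow> v \<in> ball E S k"
  unfolding ball_def by blast

lemma in_ballE:
  assumes "v \<in> ball E S k"
  obtains s where "s \<in> S" "near E k s v"
  using assms unfolding ball_def by blast

lemma subset_ball: "S \<subseteq> ball E S k"
  by (auto intro: in_ballI near_refl)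

lemma ball_mono: "S \<subseteq> S' \<Longrightarrow> k \<le> k' \<Longrightarrow> ball E S k \<subseteq> ball E S' k'"
  unfolding ball_def by (auto intro: near_mono)

lemma ball_near: "v \<in> ball E S k \<Longrightarrow> near E l v w \<Longrightarrow> w \<in> ball E S (k + l)"
  by (meson in_ballE in_ballI near_trans)

lemma ball_ball: "ball E (ball E S k) l \<subseteq> ball E S (k + l)"
  by (meson in_ballE ball_near subsetI)

lemma near_in: 
  assumes "near E k u v" "E \<subseteq> V \<times> V" "u \<in> V" shows "v \<in> V"
  using near_imp_rtrancl[OF assms(1)] assms(2,3) by (induction rule: rtrancl_induct) auto

lemma ball_sub: "E \<subseteq> V \<times> V \<Longrightarrow> S \<subseteq> V \<Longrightarrow> ball E S k \<subseteq> V"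
  by (auto elim!: in_ballE dest: near_in)

lemma nbr_sub: "E \<subseteq> V \<times> V \<Longrightarrow> nbr E A \<subseteq> V"
  unfolding nbr_def by blast

lemma nbr_disjoint: "nbr E A \<inter> A = {}"
  unfolding nbr_def by blast

lemma nbr_mono: "A \<subseteq> B \<Longrightarrow> nbr E A \<subseteq> B \<union> nbr E B"
  unfolding nbr_def by blast

lemma ball_nbr_inside:
  assumes "sym E" "v \<in> B" "S \<inter> B = {}" "v \<in> ball E S k"
  shows "v \<in> ball E (nbr E B) k"
proof -
  obtain s where s: "s \<in> S" "near E k s v" using assms(4) by (rule in_ballE)
  have "s \<notin> B" using s(1) assms(3) by blast
  with near_exit[OF near_sym[OF assms(1) s(2)] assms(2)] obtain w i j where
    "w \<in> nbr E B" "Suc i + j \<le> k" "near E (Suc i) v w" by metis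
  then show ?thesis using near_sym[OF assms(1) near_mono, of "Suc i" v w k] by (intro in_ballI) auto
qed

lemma ball_nbr_outside:
  assumes "v \<notin> B" "S \<subseteq> B \<union> nbr E B" "v \<in> ball E S k"
  shows "v \<in> ball E (nbr E B) k"
proof -
  obtain s where s: "s \<in> S" "near E k s v" using assms(3) by (rule in_ballE)
  show ?thesis
  proof (cases "s \<in> B")
    case True
    obtain w i j where "w \<in> nbr E B" "Suc i + j \<le> k" "near E j w v"
      using near_exit[OF s(2) True assms(1)] by metis
    then show ?thesis using near_mono[of E j w v k] by (intro in_ballI) auto
  next
    case False
    then show ?thesis using s assms(2) by (auto intro: in_ballI)
  qed
qed

text \<open>If \<open>U\<close> contains a ball around \<open>S\<close> whose radius is at least the diameter of \<open>S\<close>, then it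
  contains all geodesics between vertices of \<open>S\<close>, so a vertex near one vertex of \<open>S\<close> reaches all of them
  inside \<open>U\<close>.\<close>

lemma ball_intrinsic:
  assumes "sym E" "diam_le E e S" "e \<le> r" "ball E S r \<subseteq> U" "u \<in> ball E S k" "k \<le> r" "s \<in> S"
  shows "near (restr E U) (k + e) u s"
proof -
  obtain t where t: "t \<in> S" "near E k t u" using assms(5) by (rule in_ballE)
  have "near (restr E U) k t u"
  proof (rule near_inside[OF t(2)])
    fix i j w assume "i + j \<le> k" "near E i t w"
    then show "w \<in> U" using t(1) assms(4,6) near_mono[of E i t w r] by (auto intro: in_ballI)
  qed
  moreover have "near (restr E U) e t s"
  proof (rule near_inside)
    show "near E e t s" using assms(2,7) t(1) unfolding diam_le_def by blast
    fix i j w assume "i + j \<le> e" "near E i t w"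
    then show "w \<in> U" using t(1) assms(3,4) near_mono[of E i t w r] by (auto intro: in_ballI)
  qed
  moreover have "sym (restr E U)" using assms(1) unfolding sym_def by blast
  ultimately show ?thesis by (blast intro: near_sym near_trans)
qed

lemma near_restr: "near (restr E U) k u v \<Longrightarrow> near E k u v"
proof -
  assume "near (restr E U) k u v"
  moreover have "(u, v) \<in> E ^^ j" if "(u, v) \<in> restr E U ^^ j" for j
    using that by (induction j arbitrary: v) auto
  ultimately show ?thesis unfolding near_def by blast
qed

lemma comps_nonempty: "C \<in> comps E U \<Longrightarrow> C \<noteq> {}"
  unfolding comps_def by auto

lemma comps_sub: "C \<in> comps E U \<Longrightarrow> C \<subseteq> U"
proof
  fix v assume "C \<in> comps E U" "v \<in> C"
  then obtain u where "u \<in> U" "(u, v) \<in> (restr E U)\<^sup>*" unfolding comps_def by blast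
  then show "v \<in> U" by (metis IntE SigmaD2 rtranclE)
qed

lemma comps_cover: "u \<in> U \<Longrightarrow> \<exists>C\<in>comps E U. u \<in> C"
  unfolding comps_def by blast

lemma sym_restr: "sym E \<Longrightarrow> sym (restr E U)"
  unfolding sym_def by blast

lemma rtrancl_symD: "sym E \<Longrightarrow> (u, v) \<in> E\<^sup>* \<Longrightarrow> (v, u) \<in> E\<^sup>*"
  by (rule sym_rtrancl[THEN symD])

lemma comps_eq:
  assumes "sym E" "C \<in> comps E U" "u \<in> C"
  shows "C = {v. (u, v) \<in> (restr E U)\<^sup>*}"
proof -
  obtain t where t: "C = {v. (t, v) \<in> (restr E U)\<^sup>*}" using assms(2) unfolding comps_def by blast
  then have "(t, u) \<in> (restr E U)\<^sup>*" "(u, t) \<in> (restr E U)\<^sup>*"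
    using assms(3) rtrancl_symD[OF sym_restr[OF assms(1)]] by auto
  then show ?thesis unfolding t by (auto intro: rtrancl_trans)
qed

lemma comps_disjoint: "sym E \<Longrightarrow> C \<in> comps E U \<Longrightarrow> C' \<in> comps E U \<Longrightarrow> C \<noteq> C' \<Longrightarrow> C \<inter> C' = {}"
  using comps_eq[of E C U] comps_eq[of E C' U] by (metis disjoint_iff)

lemma comps_nbr: "C \<in> comps E U \<Longrightarrow> nbr E C \<inter> U = {}"
proof -
  assume C: "C \<in> comps E U"
  then obtain t where t: "C = {v. (t, v) \<in> (restr E U)\<^sup>*}" unfolding comps_def by blast
  have "w \<in> C" if "v \<in> C" "(v, w) \<in> E" "w \<in> U" for v w
    using that comps_sub[OF C] unfolding t by (auto intro: rtrancl_into_rtrancl)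
  then show ?thesis unfolding nbr_def by blast
qed

lemma comps_conn: assumes "sym E" "C \<in> comps E U" shows "conn E C"
  unfolding conn_def
proof (intro ballI)
  fix u v assume uv: "u \<in> C" "v \<in> C"
  note eq = comps_eq[OF assms uv(1)]
  have "(u, v) \<in> (restr E U)\<^sup>*" using uv(2) eq by blast
  then show "(u, v) \<in> (restr E C)\<^sup>*"
  proof (induction rule: rtrancl_induct)
    case (step y z)
    have "(u, z) \<in> (restr E U)\<^sup>*" using step(1,2) by (rule rtrancl_into_rtrancl)
    then have "y \<in> C" "z \<in> C" using step(1) eq by blast+
    with step show ?case by (auto intro: rtrancl_into_rtrancl)
  qed simp
qed

text \<open>This is how connected sets are located throughout: they cannot leave \<open>C\<close> without meeting
  its boundary.\<close>

lemma conn_inside: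
  assumes "conn E A" "A \<inter> C \<noteq> {}" "A \<inter> nbr E C = {}"
  shows "A \<subseteq> C"
proof
  fix v assume v: "v \<in> A"
  obtain u where u: "u \<in> A" "u \<in> C" using assms(2) by blast
  then have "(u, v) \<in> (restr E A)\<^sup>*" using assms(1) v unfolding conn_def by blast
  then show "v \<in> C"
  proof (induction rule: rtrancl_induct)
    case (step y z)
    then show ?case using assms(3) unfolding nbr_def by blast
  qed (rule u(2))
qed

lemma restr_rtrancl_mono: "U \<subseteq> U' \<Longrightarrow> (u, v) \<in> (restr E U)\<^sup>* \<Longrightarrow> (u, v) \<in> (restr E U')\<^sup>*"
  using rtrancl_mono[of "restr E U" "restr E U'"] by blast

lemma comps_nbr_sub: "C \<in> comps E (A - X) \<Longrightarrow> nbr E C \<subseteq> nbr E A \<union> X"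
  using comps_nbr[of C E "A - X"] comps_sub[of C E "A - X"] unfolding nbr_def by blast

section \<open>Tree-decompositions from layered laminar families\<close>

text \<open>Level \<open>n\<close> of the laminar family is \<open>F n\<close>. The same set may occur in
  several levels, so nodes of the tree are pairs of a level and a set. The bound \<open>e\<close> on the diameters of
  boundaries is also the radius of the balls in the bags.\<close>

locale layering =
  fixes E :: "('a \<times> 'a) set" and V :: "'a set" and F :: "nat \<Rightarrow> 'a set set" and e :: nat
  assumes E_sub: "E \<subseteq> V \<times> V" and E_sym: "sym E"
    and F0: "F 0 = {V}"
    and F_nonempty: "B \<in> F (Suc n) \<Longrightarrow> B \<noteq> {}"
    and F_parent: "B \<in> F (Suc n) \<Longrightarrow> \<exists>A\<in>F n. B \<subseteq> A"
    and F_apart: "A \<in> F n \<Longrightarrow> B \<in> F n \<Longrightarrow> A \<noteq> B \<Longrightarrow> (A \<union> nbr E A) \<inter> B = {}"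
    and F_escape: "v \<in> V \<Longrightarrow> \<exists>n. v \<notin> \<Union>(F n)"
    and F_diam: "A \<in> F n \<Longrightarrow> diam_le E e (nbr E A)"
begin

definition kids :: "nat \<Rightarrow> 'a set \<Rightarrow> 'a set set" where
  "kids n A = {B \<in> F (Suc n). B \<subseteq> A}"

definition core :: "nat \<Rightarrow> 'a set \<Rightarrow> 'a set" where
  "core n A = A \<union> nbr E A - \<Union>(kids n A)"

definition bag :: "nat \<times> 'a set \<Rightarrow> 'a set" where
  "bag = (\<lambda>(n, A). core n A \<union> ball E (nbr E A) e \<union> (\<Union>B\<in>kids n A. ball E (nbr E B) e))"

definition step :: "nat \<times> 'a set \<Rightarrow> nat \<times> 'a set \<Rightarrow> bool" where
  "step s t \<longleftrightarrow> snd s \<in> F (fst s) \<and> fst t = Suc (fst s) \<and> snd t \<in> kids (fst s) (snd s)"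

definition T :: "(nat \<times> 'a set) ugraph" where
  "T = \<lparr>verts = {(n, A). A \<in> F n}, adj = {(s, t). step s t \<or> step t s}\<rparr>"

text \<open>Descendants are recognized by level and inclusion, because sets of one level are
  disjoint.\<close>

definition below :: "nat \<times> 'a set \<Rightarrow> nat \<times> 'a set \<Rightarrow> bool" where
  "below s t \<longleftrightarrow> fst s \<le> fst t \<and> snd t \<subseteq> snd s"

lemma F_ancestor: "B \<in> F n \<Longrightarrow> m \<le> n \<Longrightarrow> \<exists>A\<in>F m. B \<subseteq> A"
proof (induction n arbitrary: B)
  case (Suc n)
  show ?case
  proof (cases "m = Suc n")
    case False
    then show ?thesis using Suc F_parent[OF Suc.prems(1)] by (meson le_SucE order_trans)
  qed (use Suc in auto)
qed auto

lemma F_sub: "A \<in> F n \<Longrightarrow> A \<subseteq> V"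
  using F_ancestor[of A n 0] F0 by auto

lemma F_unique: "A \<in> F n \<Longrightarrow> A' \<in> F n \<Longrightarrow> B \<noteq> {} \<Longrightarrow> B \<subseteq> A \<Longrightarrow> B \<subseteq> A' \<Longrightarrow> A = A'"
  using F_apart[of A n A'] by blast

lemma kidsD: "B \<in> kids n A \<Longrightarrow> B \<in> F (Suc n) \<and> B \<subseteq> A \<and> B \<noteq> {}"
  unfolding kids_def using F_nonempty by blast

lemma kids_apart: "B \<in> kids n A \<Longrightarrow> C \<in> F (Suc n) \<Longrightarrow> B \<noteq> C \<Longrightarrow> (B \<union> nbr E B) \<inter> C = {}"
  using F_apart kidsD by blast

lemma nbr_kid: "B \<in> kids n A \<Longrightarrow> nbr E B \<subseteq> core n A"
proof -
  assume B: "B \<in> kids n A"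
  have "nbr E B \<inter> C = {}" if "C \<in> kids n A" for C
    using kids_apart[OF B] kidsD[OF that] nbr_disjoint[of E B] by (cases "C = B") auto
  then show ?thesis using nbr_mono[of B A E] kidsD[OF B] unfolding core_def by blast
qed

lemma nbr_core: "nbr E A \<subseteq> core n A"
  using kidsD[of _ n A] nbr_disjoint[of E A] unfolding core_def by blast

lemma bag_sub: assumes "A \<in> F n" shows "bag (n, A) \<subseteq> V"
proof -
  have "ball E (nbr E B) e \<subseteq> V" for B using ball_sub[OF E_sub nbr_sub[OF E_sub]] .
  then show ?thesis
    using F_sub[OF assms] nbr_sub[OF E_sub, of A] unfolding bag_def core_def by auto
qed

lemma ball_nbr_bag: "ball E (nbr E A) e \<subseteq> bag (n, A)"
  unfolding bag_def by auto

lemma ball_kid_bag: "B \<in> kids n A \<Longrightarrow> ball E (nbr E B) e \<subseteq> bag (n, A)"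
  unfolding bag_def by auto

text \<open>The edge above the node \<open>s = (m, B)\<close> separates \<open>B\<close> from its complement, and its separator is
  the ball around \<open>N(B)\<close>: a vertex on the wrong side can be in a bag only because it is in a ball around some
  boundary, and the path to the centre of that ball crosses \<open>N(B)\<close>. This lemma and the next one treat the
  two sides of the edge, and all properties of the decomposition rest on them.\<close>

lemma bag_below_outside:
  assumes s: "snd s \<in> F (fst s)" and t: "snd t \<in> F (fst t)" and st: "below s t"
    and v: "v \<in> bag t" "v \<notin> snd s"
  shows "v \<in> ball E (nbr E (snd s)) e"
proof -
  obtain n A where tA: "t = (n, A)" by fastforce
  obtain m B where sB: "s = (m, B)" by fastforce
  have AB: "A \<subseteq> B" using st unfolding below_def tA sB by simp
  then have nA: "nbr E A \<subseteq> B \<union> nbr E B" by (rule nbr_mono)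
  from v(1) consider "v \<in> core n A" | "v \<in> ball E (nbr E A) e"
    | C where "C \<in> kids n A" "v \<in> ball E (nbr E C) e"
    unfolding tA bag_def by auto
  then show ?thesis unfolding sB snd_conv
  proof cases
    case 1
    then have "v \<in> nbr E B" using AB nA v(2) unfolding core_def sB by auto
    then show "v \<in> ball E (nbr E B) e" using subset_ball by fast
  next
    case 2
    then show "v \<in> ball E (nbr E B) e" using ball_nbr_outside nA v(2) sB by auto
  next
    case 3
    then have "nbr E C \<subseteq> B \<union> nbr E B" using kidsD[OF 3(1)] AB nbr_mono[of C B] by auto
    then show "v \<in> ball E (nbr E B) e" using ball_nbr_outside v(2) sB 3 by auto
  qed
qed

lemma bag_not_below_inside:
  assumes s: "snd s \<in> F (fst s)" and t: "snd t \<in> F (fst t)" and st: "\<not> below s t"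
    and v: "v \<in> bag t" "v \<in> snd s"
  shows "v \<in> ball E (nbr E (snd s)) e"
proof -
  obtain n A where tA: "t = (n, A)" by fastforce
  obtain m B where sB: "s = (m, B)" by fastforce
  have A: "A \<in> F n" and B: "B \<in> F m" using s t tA sB by auto
  have "core n A \<inter> B = {} \<and> nbr E A \<inter> B = {} \<and> (\<forall>C\<in>kids n A. nbr E C \<inter> B = {})"
  proof (cases "n < m")
    case True
    then obtain B' where B': "B' \<in> F (Suc n)" "B \<subseteq> B'" using F_ancestor[OF B, of "Suc n"] by auto
    obtain A' where A': "A' \<in> F n" "B' \<subseteq> A'" using F_parent[OF B'(1)] by blast
    have "nbr E C \<inter> B' = {}" if "C \<in> kids n A" for C
      using kids_apart[OF that B'(1)] nbr_disjoint[of E C] by (cases "C = B'") auto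
    moreover have "(A \<union> nbr E A - \<Union>(kids n A)) \<inter> B' = {} \<and> nbr E A \<inter> B' = {}"
    proof (cases "A = A'")
      case True
      then have "B' \<in> kids n A" using A' B' unfolding kids_def by blast
      then show ?thesis using A'(2) nbr_disjoint[of E A] True by blast
    next
      case False
      then show ?thesis using F_apart[OF A A'(1)] A'(2) by blast
    qed
    ultimately show ?thesis using B'(2) unfolding core_def by blast
  next
    case False
    then obtain A' where A': "A' \<in> F m" "A \<subseteq> A'" using F_ancestor[OF A, of m] by auto
    have "A' \<noteq> B" using st A'(2) False unfolding below_def tA sB by auto
    then have dis: "(A' \<union> nbr E A') \<inter> B = {}" using F_apart[OF A'(1) B] by blast
    have "nbr E A \<subseteq> A' \<union> nbr E A'" using nbr_mono A'(2) by metis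
    moreover have "nbr E C \<subseteq> A' \<union> nbr E A'" if "C \<in> kids n A" for C
      using kidsD[OF that] A'(2) nbr_mono[of C A' E] by blast
    ultimately show ?thesis using dis A'(2) unfolding core_def by blast
  qed
  moreover from v(1) have "v \<in> core n A \<or> v \<in> ball E (nbr E A) e
      \<or> (\<exists>C\<in>kids n A. v \<in> ball E (nbr E C) e)"
    unfolding tA bag_def by auto
  ultimately show ?thesis using v(2) ball_nbr_inside[OF E_sym] unfolding sB by auto
qed

lemma step_nodes: "step s t \<Longrightarrow> snd s \<in> F (fst s) \<and> snd t \<in> F (fst t)"
  unfolding step_def using kidsD by auto

lemma step_parent_unique:
  assumes "step s t" "step s' t" shows "s = s'"
proof -
  have "snd s = snd s'"
    using assms F_unique[of "snd s" "fst s" "snd s'" "snd t"] kidsD unfolding step_def by auto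
  then show ?thesis using assms unfolding step_def by (simp add: prod_eq_iff)
qed

lemma step_not_below: "step t s \<Longrightarrow> \<not> below s t"
  unfolding step_def below_def by auto

lemma step_below: "step t s \<Longrightarrow> below r t \<Longrightarrow> below r s"
  unfolding step_def below_def using kidsD by fastforce

text \<open>The only edge of the tree that leaves the subtree below \<open>s\<close> is the one at \<open>s\<close> itself. The
  interpolation property and acyclicity both follow from this.\<close>

lemma edge_below:
  assumes s: "snd s \<in> F (fst s)" and xy: "step x y \<or> step y x" and x: "below s x" "x \<noteq> s"
  shows "below s y"
proof (cases "step x y")
  case True
  then show ?thesis using x(1) by (rule step_below)
next
  case False
  with xy have st: "step y x" by blast
  note nodes = step_nodes[OF st]
  have ne: "snd x \<noteq> {}" using st kidsD unfolding step_def by blast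
  have xs: "snd x \<subseteq> snd s" using x(1) unfolding below_def by blast
  have yx: "snd x \<subseteq> snd y" "fst x = Suc (fst y)" using st kidsD unfolding step_def by auto
  have "fst x \<noteq> fst s"
  proof
    assume eq: "fst x = fst s"
    have "snd x = snd s" using F_unique[of "snd x" "fst x" "snd s" "snd x"] nodes s ne xs eq by auto
    then show False using eq x(2) by (simp add: prod_eq_iff)
  qed
  then have le: "fst s \<le> fst y" using x(1) yx(2) unfolding below_def by auto
  then obtain A where A: "A \<in> F (fst s)" "snd y \<subseteq> A" using F_ancestor nodes by blast
  then have "A = snd s" using F_unique[of A "fst s" "snd s" "snd x"] s ne xs yx(1) by auto
  then show ?thesis using A le unfolding below_def by auto
qed

lemma edge_below_parent:
  assumes "step t s" "step x y \<or> step y x" "below s x" "y \<noteq> t"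
  shows "below s y"
proof (cases "x = s")
  case True
  then have "step x y" using assms step_parent_unique by blast
  then show ?thesis using assms(3) by (rule step_below)
qed (use assms edge_below step_nodes in blast)

lemma successively_invariant:
  assumes "successively R (x # ys)" "P x"
    and "\<And>x y. R x y \<Longrightarrow> P x \<Longrightarrow> y \<in> set ys \<Longrightarrow> P y"
  shows "\<forall>y\<in>set (x # ys). P y"
  using assms
proof (induction ys arbitrary: x)
  case (Cons y ys)
  have "P y" using Cons.prems by auto
  then have "\<forall>z\<in>set (y # ys). P z"
    using Cons.IH[of y] Cons.prems by auto
  then show ?case using Cons.prems(2) by auto
qed auto

lemma adj_T: "(s, t) \<in> adj T \<longleftrightarrow> step s t \<or> step t s"
  unfolding T_def by simp

lemma verts_T: "t \<in> verts T \<longleftrightarrow> snd t \<in> F (fst t)"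
  unfolding T_def by (cases t) simp

lemma path_rev: "path_in T p \<Longrightarrow> path_in T (rev p)"
  unfolding path_in_def adj_T by (auto simp: disj_commute)

text \<open>The edge from \<open>t\<close> down to \<open>s\<close> separates the two ends of the path, so a vertex in both end
  bags lies in the adhesion set of that edge, which is contained in the bag of \<open>t\<close>.\<close>

lemma path_separated:
  assumes p: "path_in T (p @ t # s # q)" and st: "step t s"
  shows "bag (hd (p @ [t])) \<inter> bag (last (s # q)) \<subseteq> bag t"
proof
  fix v assume v: "v \<in> bag (hd (p @ [t])) \<inter> bag (last (s # q))"
  let ?x = "hd (p @ [t])" and ?y = "last (s # q)"
  note sn = step_nodes[OF st]
  have dist: "distinct (p @ t # s # q)" and suc: "successively (\<lambda>u v. step u v \<or> step v u) (p @ t # s # q)"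
    and nodes: "\<forall>z\<in>set (p @ t # s # q). snd z \<in> F (fst z)"
    using p unfolding path_in_def adj_T using verts_T by auto
  have "\<forall>z\<in>set (s # q). below s z"
  proof (rule successively_invariant)
    show "successively (\<lambda>u v. step u v \<or> step v u) (s # q)" using suc by (simp add: successively_append_iff successively_Cons)
    show "below s s" unfolding below_def by simp
    fix x y assume "step x y \<or> step y x" "below s x" "y \<in> set q"
    moreover have "y \<noteq> t" using \<open>y \<in> set q\<close> dist by auto
    ultimately show "below s y" using edge_below_parent[OF st] by blast
  qed
  moreover have yin: "?y \<in> set (s # q)" by (rule last_in_set) simp
  ultimately have y: "below s ?y" by (rule bspec)
  have "\<forall>z\<in>set (t # rev p). \<not> below s z"
  proof (rule successively_invariant)
    have "successively (\<lambda>u v. step u v \<or> step v u) (p @ [t])"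
      using suc by (simp add: successively_append_iff)
    then have "successively (\<lambda>u v. step u v \<or> step v u) (rev (p @ [t]))"
      unfolding successively_rev by (simp only: disj_commute)
    then show "successively (\<lambda>u v. step u v \<or> step v u) (t # rev p)" by simp
    show "\<not> below s t" using st by (rule step_not_below)
    fix x y assume xy: "step x y \<or> step y x" "\<not> below s x" "y \<in> set (rev p)"
    have "y \<noteq> s" using xy(3) dist by auto
    then show "\<not> below s y" using edge_below[of s y x] xy sn by blast
  qed
  moreover have xin: "?x \<in> set (p @ [t])" by (rule hd_in_set) simp
  ultimately have x: "\<not> below s ?x" by auto
  have nx: "snd ?x \<in> F (fst ?x)" using nodes xin by auto
  have ny: "snd ?y \<in> F (fst ?y)" using nodes yin by auto
  have "v \<in> ball E (nbr E (snd s)) e"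
    using bag_below_outside[OF conjunct2[OF sn] ny y] bag_not_below_inside[OF conjunct2[OF sn] nx x] v
    by blast
  moreover have "snd s \<in> kids (fst t) (snd t)" using st unfolding step_def by blast
  ultimately show "v \<in> bag t" using ball_kid_bag[of "snd s" "fst t" "snd t"] by auto
qed

text \<open>At an inner node \<open>t\<close> of a path, one of the two neighbours on the path is a child of \<open>t\<close>,
  since parents are unique.\<close>

lemma path_bags:
  assumes p: "path_in T p" and t: "t \<in> set p"
  shows "bag (hd p) \<inter> bag (last p) \<subseteq> bag t"
proof -
  obtain p1 p2 where eq: "p = p1 @ t # p2" using t by (meson split_list)
  show ?thesis
  proof (cases "p1 = [] \<or> p2 = []")
    case True
    then show ?thesis unfolding eq by auto
  next
    case False
    then obtain s q s' q' where q: "p2 = s # q" "p1 = q' @ [s']" by (metis neq_Nil_conv rev_exhaust)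
    have ne: "s \<noteq> s'" and ad: "step t s \<or> step s t" "step s' t \<or> step t s'"
      using p unfolding path_in_def eq q adj_T by (auto simp: successively_append_iff successively_Cons)
    then consider "step t s" | "step t s'" using step_parent_unique by blast
    then show ?thesis
    proof cases
      case 1
      have "path_in T ((q' @ [s']) @ t # s # q)" using p unfolding eq q by simp
      from path_separated[OF this 1]
      have "bag (hd ((q' @ [s']) @ [t])) \<inter> bag (last (s # q)) \<subseteq> bag t"
        unfolding q by simp
      moreover have "hd ((q' @ [s']) @ [t]) = hd p" "last (s # q) = last p"
        unfolding eq q by (auto simp: hd_append)
      ultimately show ?thesis by simp
    next
      case 2
      have "path_in T (rev p2 @ t # s' # rev q')" using path_rev[OF p] unfolding eq q by simp
      from path_separated[OF this 2]
      have "bag (hd (rev p2 @ [t])) \<inter> bag (last (s' # rev q')) \<subseteq> bag t" .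
      moreover have "hd (rev p2 @ [t]) = last p" "last (s' # rev q') = hd p"
        unfolding eq q by (auto simp: hd_append hd_rev last_rev)
      ultimately show ?thesis by auto
    qed
  qed
qed

text \<open>A path from \<open>s\<close> that ends in its parent \<open>t\<close> cannot be longer than one edge: until it reaches
  \<open>t\<close> it stays below \<open>s\<close>, and \<open>s\<close> is the only neighbour of \<open>t\<close> there.\<close>

lemma no_cycle_down:
  assumes p: "path_in T p" "length p \<ge> 3" shows "\<not> step (last p) (hd p)"
proof
  assume st: "step (last p) (hd p)"
  obtain s p' where p': "p = s # p'" using p(2) by (cases p) auto
  then obtain q t where "p' = q @ [t]" using p(2) by (cases p' rule: rev_cases) auto
  with p' have eq: "p = s # q @ [t]" by simp
  have st: "step t s" using st eq by simp
  have suc: "successively (\<lambda>u v. step u v \<or> step v u) p" and dist: "distinct p"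
    using p unfolding path_in_def adj_T by auto
  have "q \<noteq> []" using p(2) eq by auto
  then obtain q' x where q: "q = q' @ [x]" by (metis rev_exhaust)
  have "\<forall>z\<in>set (s # q). below s z"
  proof (rule successively_invariant)
    show "successively (\<lambda>u v. step u v \<or> step v u) (s # q)"
      using suc unfolding eq append_Cons[symmetric] by (auto simp only: successively_append_iff)
    show "below s s" unfolding below_def by simp
    fix x y assume "step x y \<or> step y x" "below s x" "y \<in> set q"
    moreover have "y \<noteq> t" using \<open>y \<in> set q\<close> dist eq by auto
    ultimately show "below s y" using edge_below_parent[OF st] by blast
  qed
  then have x: "below s x" unfolding q by auto
  have xs: "x \<noteq> s" using dist unfolding eq q by auto
  have "step x t \<or> step t x" using suc unfolding eq q by (auto simp: successively_append_iff successively_Cons)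
  then have "below s t" using edge_below[OF _ _ x xs] step_nodes[OF st] by blast
  then show False using step_not_below[OF st] by blast
qed

lemma node_connected: "A \<in> F n \<Longrightarrow> ((0, V), (n, A)) \<in> (adj T)\<^sup>*"
proof (induction n arbitrary: A)
  case (Suc n)
  obtain B where B: "B \<in> F n" "A \<subseteq> B" using F_parent[OF Suc.prems] by blast
  then have "step (n, B) (Suc n, A)" using Suc.prems unfolding step_def kids_def by auto
  then show ?case using Suc.IH[OF B(1)] adj_T by (meson rtrancl_into_rtrancl)
qed (simp add: F0)

lemma sym_T: "sym (adj T)"
  unfolding sym_def adj_T by blast

lemma tree_T: "tree T"
  unfolding tree_def
proof (intro conjI)
  show "simple_graph T"
    unfolding simple_graph_def
  proof (intro conjI)
    show "adj T \<subseteq> verts T \<times> verts T" using adj_T verts_T step_nodes by auto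
    show "irrefl (adj T)" unfolding irrefl_def adj_T unfolding step_def by auto
  qed (rule sym_T)
  show "verts T \<noteq> {}" unfolding T_def using F0 by auto
  show "connected_graph T"
    unfolding connected_graph_def
  proof (intro ballI)
    fix s t assume "s \<in> verts T" "t \<in> verts T"
    then have "((0, V), s) \<in> (adj T)\<^sup>*" "((0, V), t) \<in> (adj T)\<^sup>*"
      using node_connected verts_T by (metis prod.collapse)+
    then show "(s, t) \<in> (adj T)\<^sup>*" using rtrancl_symD[OF sym_T] by (meson rtrancl_trans)
  qed
  show "acyclic_graph T"
    unfolding acyclic_graph_def
  proof
    assume "\<exists>p. path_in T p \<and> 3 \<le> length p \<and> (last p, hd p) \<in> adj T"
    then obtain p where p: "path_in T p" "3 \<le> length p" "(last p, hd p) \<in> adj T" by blast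
    then have "p \<noteq> []" by auto
    then show False
      using no_cycle_down[OF p(1,2)] no_cycle_down[OF path_rev[OF p(1)]] p(2,3)
      unfolding adj_T by (simp add: hd_rev last_rev)
  qed
qed

text \<open>The maximal level of a set that contains \<open>v\<close> exists because \<open>v\<close> leaves the family
  eventually; in that level \<open>v\<close> is a core vertex.\<close>

lemma deepest:
  assumes "v \<in> V" obtains n A where "A \<in> F n" "v \<in> A" "v \<notin> \<Union>(F (Suc n))"
proof -
  let ?n = "LEAST n. v \<notin> \<Union>(F n)"
  have out: "v \<notin> \<Union>(F ?n)" using F_escape[OF assms] by (rule LeastI_ex)
  then have "?n \<noteq> 0" using F0 assms by (metis Union_iff singletonI)
  then obtain n where n: "?n = Suc n" using not0_implies_Suc by blast
  then have "v \<in> \<Union>(F n)" using not_less_Least[of n "\<lambda>n. v \<notin> \<Union>(F n)"] by auto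
  then show thesis using that out n by auto
qed

lemma escape_mono: "v \<notin> \<Union>(F n) \<Longrightarrow> n \<le> m \<Longrightarrow> v \<notin> \<Union>(F m)"
  using F_ancestor by blast

lemma core_deepest: "A \<in> F n \<Longrightarrow> v \<in> A \<union> nbr E A \<Longrightarrow> v \<notin> \<Union>(F (Suc n)) \<Longrightarrow> v \<in> bag (n, A)"
  unfolding bag_def core_def kids_def by auto

lemma edge_in_bag:
  assumes uv: "(u, v) \<in> E" and A: "A \<in> F n" "u \<in> A" and out: "u \<notin> \<Union>(F (Suc n))" "v \<notin> \<Union>(F (Suc n))"
  shows "u \<in> bag (n, A) \<and> v \<in> bag (n, A)"
  using core_deepest[OF A(1)] uv A(2) out unfolding nbr_def by blast

lemma tree_decomposition_T:
  assumes "verts G = V" "adj G = E"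
  shows "tree_decomposition G T bag"
  unfolding tree_decomposition_def
proof (intro conjI)
  show "tree T" by (rule tree_T)
  show sub: "\<forall>t\<in>verts T. bag t \<subseteq> verts G"
    unfolding assms(1) using bag_sub verts_T by (metis prod.collapse)
  show "verts G = \<Union>(bag ` verts T)"
  proof
    show "verts G \<subseteq> \<Union>(bag ` verts T)"
    proof
      fix v assume "v \<in> verts G"
      then obtain n A where "A \<in> F n" "v \<in> A" "v \<notin> \<Union>(F (Suc n))" using deepest assms by metis
      then have "v \<in> bag (n, A)" "(n, A) \<in> verts T" using core_deepest verts_T by auto
      then show "v \<in> \<Union>(bag ` verts T)" by blast
    qed
  qed (use sub in auto)
  show "\<forall>(u, v)\<in>adj G. \<exists>t\<in>verts T. u \<in> bag t \<and> v \<in> bag t"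
  proof clarify
    fix u v assume uv: "(u, v) \<in> adj G"
    then have "u \<in> V" "v \<in> V" using E_sub assms by auto
    then obtain n A m B where A: "A \<in> F n" "u \<in> A" "u \<notin> \<Union>(F (Suc n))"
      and B: "B \<in> F m" "v \<in> B" "v \<notin> \<Union>(F (Suc m))" by (metis deepest)
    have vu: "(v, u) \<in> E" using uv assms E_sym by (auto dest: symD)
    show "\<exists>t\<in>verts T. u \<in> bag t \<and> v \<in> bag t"
    proof (cases "n \<le> m")
      case True
      then have "u \<notin> \<Union>(F (Suc m))" using escape_mono[OF A(3), of "Suc m"] by auto
      then show ?thesis using edge_in_bag[OF vu B(1,2,3)] B(1) verts_T
        by (intro bexI[of _ "(m, B)"]) auto
    next
      case False
      then have "v \<notin> \<Union>(F (Suc n))" using escape_mono[OF B(3), of "Suc n"] by auto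
      then show ?thesis using edge_in_bag[of u v A n] uv assms A verts_T
        by (intro bexI[of _ "(n, A)"]) auto
    qed
  qed
  show "\<forall>p. path_in T p \<longrightarrow> (\<forall>t\<in>set p. bag (hd p) \<inter> bag (last p) \<subseteq> bag t)"
    using path_bags by blast
qed

lemma adhesion_step:
  assumes "step s t" shows "bag s \<inter> bag t = ball E (nbr E (snd t)) e"
proof
  note sn = step_nodes[OF assms]
  have "below t t" unfolding below_def by simp
  then show "bag s \<inter> bag t \<subseteq> ball E (nbr E (snd t)) e"
    using bag_below_outside[of t t] bag_not_below_inside[of t s] step_not_below[OF assms] sn by blast
  show "ball E (nbr E (snd t)) e \<subseteq> bag s \<inter> bag t"
    using ball_nbr_bag[of "snd t" "fst t"] ball_kid_bag[of "snd t" "fst s" "snd s"] assms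
    unfolding step_def prod.collapse by blast
qed

text \<open>The route is \<open>u\<close> to \<open>S\<close>, across \<open>S\<close> along a geodesic of length at most
  \<open>e\<close>, then \<open>S\<close> to \<open>v\<close>. All of it stays within distance \<open>e\<close> of \<open>S\<close>.\<close>

lemma near_in_ball:
  assumes "diam_le E e S" "ball E S e \<subseteq> U" "u \<in> ball E S e" "v \<in> ball E S e"
  shows "near (restr E U) (e + e + e) u v"
proof -
  obtain s where s: "s \<in> S" "near E e s v" using assms(4) by (rule in_ballE)
  have us: "near (restr E U) (e + e) u s"
    by (rule ball_intrinsic[OF E_sym assms(1) order_refl assms(2,3) order_refl s(1)])
  have "near (restr E U) e s v"
    by (rule near_inside[OF s(2)]) (use s(1) assms(2) near_mono[of E _ s _ e] in_ballI[of s S E e] in auto)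
  then show ?thesis using us by (rule near_trans[rotated])
qed

lemma adhesion_near:
  assumes "(s, t) \<in> adj T" "u \<in> bag s \<inter> bag t" "v \<in> bag s \<inter> bag t"
  shows "near (restr E (bag s \<inter> bag t)) (e + e + e) u v"
proof -
  have "\<exists>A n. A \<in> F n \<and> bag s \<inter> bag t = ball E (nbr E A) e"
    using assms(1) adhesion_step[of s t] adhesion_step[of t s] step_nodes unfolding adj_T by blast
  then obtain A n where "A \<in> F n" "bag s \<inter> bag t = ball E (nbr E A) e" by blast
  then show ?thesis using near_in_ball[OF F_diam] assms(2,3) by auto
qed

section \<open>Distances inside bags\<close>

text \<open>The parts of the graph beyond the core of a bag, each with its separator: the outside of \<open>A\<close>
  behind \<open>N(A)\<close>, and every child \<open>B\<close> behind \<open>N(B)\<close>. Up and down directions are symmetric in all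
  distance arguments about a single bag.\<close>

definition wings :: "nat \<Rightarrow> 'a set \<Rightarrow> ('a set \<times> 'a set) set" where
  "wings n A = insert (V - (A \<union> nbr E A), nbr E A) ((\<lambda>B. (B, nbr E B)) ` kids n A)"

lemma wing_cases:
  assumes "(B, S) \<in> wings n A"
  obtains "B = V - (A \<union> nbr E A)" "S = nbr E A" | "B \<in> kids n A" "S = nbr E B"
  using assms unfolding wings_def by auto

lemma wing:
  assumes A: "A \<in> F n" and w: "(B, S) \<in> wings n A"
  shows "nbr E B \<subseteq> S" "S \<subseteq> core n A" "B \<inter> core n A = {}" "ball E S e \<subseteq> bag (n, A)"
    "diam_le E e S" "B \<inter> bag (n, A) \<subseteq> ball E S e"
proof -
  have "nbr E B \<subseteq> S \<and> S \<subseteq> core n A \<and> B \<inter> core n A = {} \<and> ball E S e \<subseteq> bag (n, A) \<and>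
    diam_le E e S \<and> B \<inter> bag (n, A) \<subseteq> ball E S e"
    using w
  proof (cases rule: wing_cases)
    case 1
    have "nbr E B \<subseteq> S"
      unfolding 1 using E_sub symD[OF E_sym] unfolding nbr_def by fastforce
    moreover have "B \<inter> bag (n, A) \<subseteq> ball E S e"
      using bag_below_outside[of "(n, A)" "(n, A)"] A unfolding 1 below_def by auto
    ultimately show ?thesis
      using nbr_core[of A n] F_diam[OF A] ball_nbr_bag unfolding 1 core_def by auto
  next
    case 2
    note B = kidsD[OF 2(1)]
    have "\<not> below (Suc n, B) (n, A)" unfolding below_def by simp
    then have "B \<inter> bag (n, A) \<subseteq> ball E S e"
      using bag_not_below_inside[of "(Suc n, B)" "(n, A)"] A B unfolding 2 by auto
    then show ?thesis
      using nbr_kid[OF 2(1)] F_diam[of B "Suc n"] B ball_kid_bag[OF 2(1)] 2(1)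
      unfolding 2(2) core_def by auto
  qed
  then show "nbr E B \<subseteq> S" "S \<subseteq> core n A" "B \<inter> core n A = {}" "ball E S e \<subseteq> bag (n, A)"
    "diam_le E e S" "B \<inter> bag (n, A) \<subseteq> ball E S e" by blast+
qed

lemma outside_core: "v \<in> V \<Longrightarrow> v \<notin> core n A \<Longrightarrow> \<exists>B S. (B, S) \<in> wings n A \<and> v \<in> B"
  unfolding wings_def core_def by blast

lemma core_bag: "core n A \<subseteq> bag (n, A)"
  unfolding bag_def by auto

text \<open>A vertex outside the bag lies in some wing at distance more than \<open>e\<close> from its separator. A
  geodesic through it would cross the separator before and after, and could be shortened, as the separator has
  diameter at most \<open>e\<close>.\<close>

lemma core_geodesic:
  assumes A: "A \<in> F n" and uv: "near E k u v" "u \<in> core n A" "v \<in> core n A"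
  shows "near (restr E (bag (n, A))) k u v"
proof -
  let ?l = "LEAST l. near E l u v"
  have l: "near E ?l u v" using uv(1) by (rule LeastI)
  have min: "?l \<le> i" if "near E i u v" for i using that by (rule Least_le)
  have "near (restr E (bag (n, A))) ?l u v"
  proof (rule near_inside[OF l], rule ccontr)
    fix i j w assume w: "i + j \<le> ?l" "near E i u w" "near E j w v" "w \<notin> bag (n, A)"
    have "w \<in> V"
      using near_in[OF w(2) E_sub] uv(2) core_bag[of n A] bag_sub[OF A] by blast
    moreover have "w \<notin> core n A" using w(4) core_bag by blast
    ultimately obtain B S where BS: "(B, S) \<in> wings n A" "w \<in> B" using outside_core by blast
    note W = wing[OF A BS(1)]
    have "u \<notin> B" "v \<notin> B" using W(3) uv(2,3) by auto
    obtain s i1 i2 where s: "s \<in> nbr E B" "Suc i1 + i2 \<le> i" "near E (Suc i1) w s" "near E i2 s u"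
      using near_exit[OF near_sym[OF E_sym w(2)] BS(2) \<open>u \<notin> B\<close>] by metis
    obtain s' j1 j2 where s': "s' \<in> nbr E B" "Suc j1 + j2 \<le> j" "near E (Suc j1) w s'" "near E j2 s' v"
      using near_exit[OF w(3) BS(2) \<open>v \<notin> B\<close>] by metis
    \<comment> \<open>Both crossings are more than \<open>e\<close> away from \<open>w\<close>, so the shortcut from \<open>s\<close> to \<open>s'\<close> is shorter.\<close>
    have "w \<notin> ball E S e" using w(4) W(4) by blast
    then have far: "\<not> near E e s w" using s(1) W(1) by (auto intro: in_ballI)
    then have "e < Suc i1" using near_mono[OF near_sym[OF E_sym s(3)], of e] by (meson not_le)
    moreover have "near E e s s'" using W(1,5) s(1) s'(1) unfolding diam_le_def by blast
    then have "near E (i2 + e + j2) u v"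
      using near_trans near_sym[OF E_sym s(4)] s'(4) by metis
    then have "?l \<le> i2 + e + j2" by (rule min)
    ultimately show False using s(2) s'(2) w(1) by linarith
  qed
  moreover have "?l \<le> k" using uv(1) by (rule min)
  ultimately show ?thesis by (rule near_mono)
qed

text \<open>A walk from \<open>v\<close> to \<open>u\<close> leaves the wing of \<open>v\<close> through its separator; the crossing point \<open>w\<close>
  is in the core, is not farther from \<open>u\<close> than \<open>v\<close>, and is reached from \<open>v\<close> inside the ball.\<close>

lemma retreat_to_core:
  assumes A: "A \<in> F n" and v: "v \<in> bag (n, A)" and uv: "near E k u v"
    and apart: "\<And>B S. (B, S) \<in> wings n A \<Longrightarrow> v \<in> B \<Longrightarrow> u \<notin> B"
  obtains w where "w \<in> core n A" "near E k u w" "near (restr E (bag (n, A))) (e + e) v w"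
proof (cases "v \<in> core n A")
  case True
  then show ?thesis using that uv by auto
next
  case False
  then obtain B S where BS: "(B, S) \<in> wings n A" "v \<in> B" using outside_core bag_sub[OF A] v by blast
  note W = wing[OF A BS(1)]
  obtain w i j where w: "w \<in> nbr E B" "Suc i + j \<le> k" "near E j w u"
    using near_exit[OF near_sym[OF E_sym uv] BS(2) apart[OF BS]] by metis
  have "w \<in> S" using w(1) W(1) by blast
  moreover have "v \<in> ball E S e" using W(6) v BS(2) by blast
  ultimately have "near (restr E (bag (n, A))) (e + e) v w"
    using ball_intrinsic[OF E_sym W(5) order_refl W(4), of v e w] by blast
  moreover have "near E k u w" using near_sym[OF E_sym w(3)] w(2) near_mono[of E j u w k] by auto
  ultimately show ?thesis using that \<open>w \<in> S\<close> W(2) by blast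
qed

text \<open>Both ends retreat to the core, at a cost of \<open>2e\<close> each; between core vertices nothing is
  lost. If both ends are in the same wing, the ball around its separator connects them directly.\<close>

lemma bag_distortion:
  assumes A: "A \<in> F n" and uv: "u \<in> bag (n, A)" "v \<in> bag (n, A)" "near E k u v"
  shows "near (restr E (bag (n, A))) (k + 4 * e) u v"
proof (cases "\<exists>B S. (B, S) \<in> wings n A \<and> u \<in> B \<and> v \<in> B")
  case True
  then obtain B S where BS: "(B, S) \<in> wings n A" "u \<in> B" "v \<in> B" by blast
  note W = wing[OF A BS(1)]
  have "near (restr E (bag (n, A))) (e + e + e) u v"
    using near_in_ball[OF W(5,4)] W(6) BS uv by blast
  then show ?thesis using near_mono by fastforce
next
  case False
  have sy: "sym (restr E (bag (n, A)))" using E_sym by (rule sym_restr)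
  obtain v' where v': "v' \<in> core n A" "near E k u v'" "near (restr E (bag (n, A))) (e + e) v v'"
    using retreat_to_core[OF A uv(2,3)] False by metis
  have "\<And>B S. (B, S) \<in> wings n A \<Longrightarrow> u \<in> B \<Longrightarrow> v' \<notin> B" using wing(3)[OF A] v'(1) by blast
  then obtain u' where u': "u' \<in> core n A" "near E k v' u'" "near (restr E (bag (n, A))) (e + e) u u'"
    using retreat_to_core[OF A uv(1) near_sym[OF E_sym v'(2)]] by metis
  have "near (restr E (bag (n, A))) k u' v'"
    using core_geodesic[OF A near_sym[OF E_sym u'(2)] u'(1) v'(1)] .
  then have "near (restr E (bag (n, A))) ((e + e) + k + (e + e)) u v"
    using near_trans[OF near_trans[OF u'(3)] near_sym[OF sy v'(3)]] by blast
  then show ?thesis using near_mono[of _ "(e + e) + k + (e + e)" u v "k + 4 * e"] by simp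
qed

end

lemma additive_distortionI:
  assumes "U \<subseteq> verts G"
    and "\<And>u v k. u \<in> U \<Longrightarrow> v \<in> U \<Longrightarrow> near (adj G) k u v \<Longrightarrow> near (restr (adj G) U) (k + c) u v"
  shows "additive_distortion_le c (induced G U) G id"
proof -
  have a: "adj (induced G U) = restr (adj G) U" by (simp add: induced_def)
  have "gdist (induced G U) u v - enat c \<le> gdist G u v \<and> gdist G u v \<le> gdist (induced G U) u v + enat c"
    if uv: "u \<in> U" "v \<in> U" for u v
  proof
    show "gdist (induced G U) u v - enat c \<le> gdist G u v"
    proof (cases "gdist G u v")
      case (enat k)
      then have "near (adj G) k u v" using gdist_le_iff[of G u v k] by simp
      then have "gdist (induced G U) u v \<le> enat (k + c)"
        using assms(2)[OF uv] gdist_le_iff[of "induced G U"] a by simp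
      then show ?thesis unfolding enat by (cases "gdist (induced G U) u v") auto
    qed simp
    have "gdist G u v \<le> gdist (induced G U) u v"
    proof (cases "gdist (induced G U) u v")
      case (enat k)
      then have "near (adj (induced G U)) k u v" using gdist_le_iff[of "induced G U" u v k] by simp
      then have "near (adj G) k u v" unfolding a by (rule near_restr)
      then show ?thesis unfolding enat gdist_le_iff .
    qed simp
    then show "gdist G u v \<le> gdist (induced G U) u v + enat c" by (simp add: add_increasing2)
  qed
  then show ?thesis unfolding additive_distortion_le_def by (auto simp: induced_def)
qed

lemma intrinsic_diamI:
  assumes "\<And>u v. u \<in> U \<Longrightarrow> v \<in> U \<Longrightarrow> near (restr (adj G) U) c u v"
  shows "intrinsic_diam G U \<le> enat c"
  unfolding intrinsic_diam_def
  by (rule Least_le) (use assms in \<open>simp add: gdist_le_iff induced_def\<close>)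

context layering
begin

lemma layering_bounds:
  assumes G: "verts G = V" "adj G = E" and e: "e = 4 * d + 2"
  shows "tree_decomposition G T bag"
    "\<forall>(s, t)\<in>adj T. intrinsic_diam G (bag s \<inter> bag t) \<le> enat (15 * d + 8)"
    "\<forall>t\<in>verts T. additive_distortion_le (20 * d + 12) (induced G (bag t)) G id"
proof -
  show "tree_decomposition G T bag" using G by (rule tree_decomposition_T)
  show "\<forall>(s, t)\<in>adj T. intrinsic_diam G (bag s \<inter> bag t) \<le> enat (15 * d + 8)"
  proof (clarify, rule intrinsic_diamI)
    fix n A m B u v assume st: "((n, A), (m, B)) \<in> adj T"
      and uv: "u \<in> bag (n, A) \<inter> bag (m, B)" "v \<in> bag (n, A) \<inter> bag (m, B)"
    have "e + e + e \<le> 15 * d + 8" using e by simp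
    then show "near (restr (adj G) (bag (n, A) \<inter> bag (m, B))) (15 * d + 8) u v"
      using near_mono[OF adhesion_near[OF st uv]] unfolding G by blast
  qed
  show "\<forall>t\<in>verts T. additive_distortion_le (20 * d + 12) (induced G (bag t)) G id"
  proof clarify
    fix n A assume "(n, A) \<in> verts T"
    then have A: "A \<in> F n" using verts_T by simp
    show "additive_distortion_le (20 * d + 12) (induced G (bag (n, A))) G id"
    proof (rule additive_distortionI)
      show "bag (n, A) \<subseteq> verts G" using bag_sub[OF A] G by simp
      fix u v k assume uv: "u \<in> bag (n, A)" "v \<in> bag (n, A)" "near (adj G) k u v"
      have "k + 4 * e \<le> k + (20 * d + 12)" using e by simp
      then show "near (restr (adj G) (bag (n, A))) (k + (20 * d + 12)) u v"
        using near_mono[OF bag_distortion[OF A uv(1,2)]] uv(3) unfolding G by blast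
    qed
  qed
qed

end


section \<open>Outer-torsos as quotients\<close>

lemma near_avoiding:
  assumes "near E k u v" "\<forall>z\<in>Z. \<not> near E k u z"
  shows "(u, v) \<in> (restr E (- Z))\<^sup>*"
proof (rule near_imp_rtrancl[OF near_inside[OF assms(1)]])
  fix i j w assume "i + j \<le> k" "near E i u w"
  then show "w \<in> - Z" using assms(2) near_mono[of E i u w k] by auto
qed

text \<open>Each vertex of a geodesic of length at most \<open>d\<close> is within \<open>\<lfloor>d/2\<rfloor>\<close> of one of its
  ends. This is why lobes are required to have their boundary at distance more than \<open>\<lfloor>d/2\<rfloor>\<close> from the
  anchor.\<close>

lemma linked_in_ball:
  assumes "sym E" "diam_le E d S" "ball E S (d div 2) \<subseteq> U" "u \<in> S" "v \<in> S"
  shows "(u, v) \<in> (restr E U)\<^sup>*"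
proof (rule near_imp_rtrancl[OF near_inside])
  show "near E d u v" using assms(2,4,5) unfolding diam_le_def by blast
  fix i j w assume w: "i + j \<le> d" "near E i u w" "near E j w v"
  then have "i \<le> d div 2 \<or> j \<le> d div 2" by linarith
  then have "near E (d div 2) u w \<or> near E (d div 2) v w"
    using near_mono[OF w(2)] near_mono[OF near_sym[OF assms(1) w(3)]] by blast
  then show "w \<in> U" using assms(3-5) by (auto intro: in_ballI)
qed

locale cgraph =
  fixes G :: "'a ugraph"
  assumes simple: "simple_graph G" and connected: "connected_graph G"
begin

abbreviation "E \<equiv> adj G"
abbreviation "V \<equiv> verts G"

lemma E_sub: "E \<subseteq> V \<times> V" and E_sym: "sym E"
  using simple unfolding simple_graph_def by auto

lemma reach: "u \<in> V \<Longrightarrow> v \<in> V \<Longrightarrow> (u, v) \<in> E\<^sup>*"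
  using connected unfolding connected_graph_def by blast

lemma reach_near: assumes "u \<in> V" "v \<in> V" obtains k where "near E k u v"
  using reach[OF assms] rtrancl_imp_relpow near_relpow by metis

lemma reach_boundary:
  assumes "v \<in> V" "v \<notin> B" "B \<noteq> {}" "B \<subseteq> V"
  obtains s where "s \<in> nbr E B" "(v, s) \<in> (restr E (- B))\<^sup>*"
proof -
  obtain b where b: "b \<in> B" using assms(3) by blast
  then have "(v, b) \<in> E\<^sup>*" using assms reach by blast
  then have "b \<in> B \<longrightarrow> (\<exists>s. s \<in> nbr E B \<and> (v, s) \<in> (restr E (- B))\<^sup>*)"
    and "b \<notin> B \<longrightarrow> (v, b) \<in> (restr E (- B))\<^sup>* \<or> (\<exists>s. s \<in> nbr E B \<and> (v, s) \<in> (restr E (- B))\<^sup>*)"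
  proof (induction rule: rtrancl_induct)
    case (step y z)
    {
      case 1
      then show ?case using step symD[OF E_sym step(2)] unfolding nbr_def by blast
    next
      case 2
      show ?case
      proof (cases "y \<in> B")
        case False
        then show ?thesis using step by (metis (no_types, lifting) ComplI IntI SigmaI rtrancl_into_rtrancl)
      qed (use step in blast)
    }
  qed (use assms(2) in auto)
  with b that show thesis by blast
qed

lemma nbr_nonempty: "v \<in> V \<Longrightarrow> v \<notin> B \<Longrightarrow> B \<noteq> {} \<Longrightarrow> B \<subseteq> V \<Longrightarrow> nbr E B \<noteq> {}"
  using reach_boundary by blast

end

locale torso = cgraph +
  fixes W :: "'a set"
  assumes W_sub: "W \<subseteq> verts G" and W_nonempty: "W \<noteq> {}"
begin

abbreviation "Q \<equiv> adj (outer_torso G W)"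
abbreviation "VQ \<equiv> verts (outer_torso G W)"

text \<open>The quotient map from the graph to its outer-torso: the branch set that contains \<open>v\<close>.\<close>

definition branch :: "'a \<Rightarrow> 'a set" where
  "branch v = (if v \<in> W then {v} else {y. (v, y) \<in> (restr E (V - W))\<^sup>*})"

lemma VQ_eq: "VQ = (\<lambda>v. {v}) ` W \<union> comps E (V - W)"
proof -
  have "components (delete G W) = comps E (V - W)"
    unfolding components_def comps_def delete_def induced_def by (auto simp: Int_absorb1)
  then show ?thesis unfolding outer_torso_def Let_def by simp
qed

lemma Q_iff: "(X, Y) \<in> Q \<longleftrightarrow> X \<in> VQ \<and> Y \<in> VQ \<and> X \<noteq> Y \<and> (\<exists>x\<in>X. \<exists>y\<in>Y. (x, y) \<in> E)"
  unfolding outer_torso_def Let_def by simp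

lemma Q_sub: "Q \<subseteq> VQ \<times> VQ" using Q_iff by auto

lemma Q_sym: "sym Q"
  unfolding sym_def Q_iff using symD[OF E_sym] by blast

lemma VQ_cases:
  assumes "X \<in> VQ"
  obtains v where "v \<in> W" "X = {v}" | "X \<in> comps E (V - W)"
  using assms unfolding VQ_eq by blast

lemma VQ_sub: "X \<in> VQ \<Longrightarrow> X \<subseteq> V"
  by (erule VQ_cases) (use W_sub comps_sub in blast)+

lemma VQ_nonempty: "X \<in> VQ \<Longrightarrow> X \<noteq> {}"
  by (erule VQ_cases) (use comps_nonempty in blast)+

lemma in_branch: "v \<in> branch v"
  unfolding branch_def by auto

lemma branch_bag: "v \<in> W \<Longrightarrow> branch v = {v}"
  unfolding branch_def by simp

lemma branch_in: "v \<in> V \<Longrightarrow> branch v \<in> VQ"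
  unfolding VQ_eq branch_def comps_def by auto

lemma branch_eq: "X \<in> VQ \<Longrightarrow> x \<in> X \<Longrightarrow> branch x = X"
proof (erule VQ_cases)
  assume "x \<in> X" "X \<in> comps E (V - W)"
  then show "branch x = X" using comps_sub[of X E "V - W"] comps_eq[OF E_sym, of X "V - W" x]
    unfolding branch_def by auto
qed (auto simp: branch_def)

lemma branch_edge: "(u, v) \<in> E \<Longrightarrow> branch u = branch v \<or> (branch u, branch v) \<in> Q"
  unfolding Q_iff using branch_in in_branch E_sub by blast

lemma branch_near: "near E k u v \<Longrightarrow> near Q k (branch u) (branch v)"
proof -
  have "near Q j (branch u) (branch v)" if "(u, v) \<in> E ^^ j" for j
    using that
  proof (induction j arbitrary: v)
    case (Suc j)
    then obtain w where w: "(u, w) \<in> E ^^ j" "(w, v) \<in> E" by auto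
    have "near Q (Suc 0) (branch w) (branch v)" using branch_edge[OF w(2)] near_edge by auto
    then show ?case using near_trans[OF Suc.IH[OF w(1)], of "Suc 0"] by simp
  qed simp
  moreover assume "near E k u v"
  ultimately show ?thesis unfolding near_def[of E] by (meson near_mono)
qed

lemma branch_linked:
  assumes "(u, v) \<in> (restr E U)\<^sup>*" "\<And>w. w \<in> U \<Longrightarrow> branch w \<notin> Z"
  shows "(branch u, branch v) \<in> (restr Q (- Z))\<^sup>*"
  using assms(1)
proof (induction rule: rtrancl_induct)
  case (step y z)
  then have "branch y = branch z \<or> (branch y, branch z) \<in> restr Q (- Z)" using branch_edge[of y z] assms(2) by blast
  then show ?case using step.IH by (metis rtrancl_into_rtrancl)
qed simp

text \<open>It therefore suffices to study distances from bag vertices, at the price of one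
  step.\<close>

lemma touches_bag:
  assumes "X \<in> VQ"
  obtains v where "v \<in> W" "near Q (Suc 0) X (branch v)"
  using assms
proof (cases rule: VQ_cases)
  case (1 v)
  then show ?thesis using that[of v] branch_bag by simp
next
  case 2
  obtain w where w: "w \<in> W" using W_nonempty by blast
  have "w \<notin> X" "X \<subseteq> V" using comps_sub[OF 2] w by auto
  then obtain s where s: "s \<in> nbr E X"
    using nbr_nonempty[of w X] W_sub w comps_nonempty[OF 2] by blast
  then have "s \<in> V" using E_sub unfolding nbr_def by blast
  then have "s \<in> W" using comps_nbr[OF 2] s by blast
  obtain x where x: "x \<in> X" "(x, s) \<in> E" using s unfolding nbr_def by blast
  have "near Q (Suc 0) (branch x) (branch s)" using branch_near near_edge x(2) by metis
  then show ?thesis using that[OF \<open>s \<in> W\<close>] branch_eq[OF assms x(1)] by simp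
qed

lemma fibre_connected:
  assumes "X \<in> VQ" "X \<notin> Z" "x \<in> X" "y \<in> X"
  shows "(x, y) \<in> (restr E {v. branch v \<notin> Z})\<^sup>*"
  using assms(1)
proof (cases rule: VQ_cases)
  case 2
  then have "(x, y) \<in> (restr E X)\<^sup>*" using comps_conn[OF E_sym 2] assms(3,4) unfolding conn_def by blast
  moreover have "X \<subseteq> {v. branch v \<notin> Z}" using branch_eq[OF assms(1)] assms(2) by auto
  ultimately show ?thesis using restr_rtrancl_mono by metis
qed (use assms in auto)

text \<open>Separation passes from the torso to the graph: a walk of the torso off \<open>Z\<close>
  lifts, as branch sets are connected and every vertex of the lift has its branch set outside \<open>Z\<close>.\<close>

lemma linked_lift:
  assumes "(X, Y) \<in> (restr Q (- Z))\<^sup>*" "X \<in> VQ" "X \<notin> Z" "x \<in> X"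
  shows "\<forall>y\<in>Y. (x, y) \<in> (restr E {v. branch v \<notin> Z})\<^sup>*"
  using assms(1)
proof (induction rule: rtrancl_induct)
  case base
  then show ?case using fibre_connected assms by blast
next
  case (step Y Y')
  then obtain y y' where y: "y \<in> Y" "y' \<in> Y'" "(y, y') \<in> E" and Y: "Y \<in> VQ" "Y' \<in> VQ" "Y \<notin> Z" "Y' \<notin> Z"
    using Q_iff by blast
  have "(y, y') \<in> restr E {v. branch v \<notin> Z}" using y Y branch_eq by auto
  then have "(x, y') \<in> (restr E {v. branch v \<notin> Z})\<^sup>*" using step.IH y(1) by (meson rtrancl_into_rtrancl)
  then show ?case using fibre_connected[OF Y(2,4) y(2)] by (meson rtrancl_trans)
qed

text \<open>A contracted component cannot cross a separator that is contained in the bag, and it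
  begins only beyond the ball around the separator.\<close>

lemma contracted_in_wing:
  assumes Y: "Y \<in> VQ" "y \<in> Y" "y \<notin> W" "y \<in> B" and S: "nbr E B \<subseteq> S" "ball E S r \<subseteq> W"
  shows "Y \<subseteq> B - ball E S r"
  using Y(1)
proof (cases rule: VQ_cases)
  case (1 v)
  then show ?thesis using Y by simp
next
  case 2
  have "Y \<inter> W = {}" using comps_sub[OF 2] by blast
  moreover have "S \<subseteq> W" using S(2) subset_ball[of S E r] by blast
  ultimately have "Y \<subseteq> B" using conn_inside[OF comps_conn[OF E_sym 2], of B] Y S(1) by blast
  then show ?thesis using \<open>Y \<inter> W = {}\<close> S(2) by blast
qed

text \<open>Contracting components creates no shortcuts towards the separator \<open>S\<close>: the depth in the wing
  \<open>B\<close>, up to \<open>r\<close>, decreases by at most one along an edge of the torso, because a contracted component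
  in the wing lies outside the ball of radius \<open>r\<close> and so all its neighbours have depth at least \<open>r\<close>.\<close>

lemma deep_step:
  assumes "X \<subseteq> B - ball E S (Suc k)" "(X, Y) \<in> Q" "k \<le> r"
    and S: "nbr E B \<subseteq> S" "ball E S r \<subseteq> W"
  shows "Y \<subseteq> B - ball E S k"
proof -
  obtain x y where xy: "x \<in> X" "y \<in> Y" "(x, y) \<in> E" and Y: "Y \<in> VQ" using assms(2) Q_iff by blast
  have x: "x \<in> B" "x \<notin> ball E S (Suc k)" using xy(1) assms(1) by auto
  have yx: "near E (Suc 0) y x" using symD[OF E_sym xy(3)] by (rule near_edge)
  have yk: "y \<notin> ball E S k" using ball_near[OF _ yx, of S k] x(2) by auto
  have "y \<in> B"
  proof (rule ccontr)
    assume "y \<notin> B"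
    then have "y \<in> S" using S(1) x(1) xy(3) unfolding nbr_def by blast
    then show False using yk subset_ball[of S E k] by blast
  qed
  show ?thesis
  proof (cases "y \<in> W")
    case True
    then have "Y = {y}" using branch_eq[OF Y xy(2)] branch_bag by simp
    then show ?thesis using \<open>y \<in> B\<close> yk by simp
  next
    case False
    have "Y \<subseteq> B - ball E S r" using contracted_in_wing[OF Y xy(2) False \<open>y \<in> B\<close> S] .
    then show ?thesis using ball_mono[OF order_refl assms(3), of E S] by blast
  qed
qed

lemma deep_near:
  assumes "near Q j X Y" "X \<subseteq> B - ball E S (k + j)" "k + j \<le> r"
    and S: "nbr E B \<subseteq> S" "ball E S r \<subseteq> W"
  shows "Y \<subseteq> B - ball E S k"
proof -
  obtain i where i: "i \<le> j" "(X, Y) \<in> Q ^^ i" using assms(1) unfolding near_def by blast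
  have "Y \<subseteq> B - ball E S k" if "X \<subseteq> B - ball E S (k + i)" "k + i \<le> r" for k
    using i(2) that
  proof (induction i arbitrary: Y k)
    case (Suc i)
    then obtain Y' where Y': "(X, Y') \<in> Q ^^ i" "(Y', Y) \<in> Q" by auto
    have "Y' \<subseteq> B - ball E S (Suc k)" using Suc.IH[OF Y'(1), of "Suc k"] Suc.prems by simp
    then show ?case using deep_step[OF _ Y'(2) _ S] Suc.prems by simp
  qed simp
  moreover have "X \<subseteq> B - ball E S (k + i)"
    using assms(2) ball_mono[OF order_refl, of "k + i" "k + j" E S] i(1) by auto
  ultimately show ?thesis using i(1) assms(3) by simp
qed

text \<open>Distances up to \<open>d\<close> are the same in the torso and in the graph as long as no contracted vertex
  is within reach.\<close>

lemma near_lift: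
  assumes "\<And>Y. Y \<in> VQ \<Longrightarrow> near Q d {z} Y \<Longrightarrow> \<exists>y\<in>W. Y = {y}" and "near Q d {z} {z'}"
  shows "near E d z z'"
proof -
  have "\<exists>y. Y = {y} \<and> (z, y) \<in> E ^^ j" if "(({z}), Y) \<in> Q ^^ j" "j \<le> d" for j Y
    using that
  proof (induction j arbitrary: Y)
    case (Suc j)
    then obtain Y' where Y': "({z}, Y') \<in> Q ^^ j" "(Y', Y) \<in> Q" by auto
    then obtain y' where y': "Y' = {y'}" "(z, y') \<in> E ^^ j" using Suc by auto
    have "near Q d {z} Y" using near_mono[OF near_relpow[OF Suc.prems(1)] Suc.prems(2)] .
    then obtain y where "Y = {y}" using assms(1) Y'(2) Q_iff by blast
    moreover have "(y', y) \<in> E" using Y'(2) unfolding y'(1) \<open>Y = {y}\<close> Q_iff by simp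
    ultimately show ?case using y'(2) by auto
  qed auto
  then show ?thesis using assms(2) unfolding near_def by blast
qed

lemma inseparableI:
  assumes "\<And>Z X Y. Z \<subseteq> VQ \<Longrightarrow> diam_le Q d Z \<Longrightarrow> X \<in> VQ \<Longrightarrow> Y \<in> VQ \<Longrightarrow>
    \<forall>S\<in>Z. \<not> near Q D X S \<Longrightarrow> \<forall>S\<in>Z. \<not> near Q D Y S \<Longrightarrow> (X, Y) \<in> (restr Q (- Z))\<^sup>*"
  shows "inseparable_graph d D (outer_torso G W)"
  unfolding inseparable_graph_def inseparable_in_def
proof (intro allI impI ballI)
  let ?O = "outer_torso G W"
  fix Z X Y assume Z: "Z \<subseteq> VQ \<and> diam ?O Z \<le> enat d" and X: "X \<in> VQ" and Y: "Y \<in> VQ"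
  have "\<forall>u\<in>Z. \<forall>v\<in>Z. gdist ?O u v \<le> diam ?O Z"
    unfolding diam_def by (rule LeastI[of _ \<infinity>]) simp
  then have "gdist ?O u v \<le> enat d" if "u \<in> Z" "v \<in> Z" for u v
    using Z that by (meson order_trans)
  then have dZ: "diam_le Q d Z" unfolding diam_le_def gdist_le_iff by blast
  have far: "\<not> near Q D U S" if "\<not> gdist_sets ?O {U} Z \<le> enat D" "S \<in> Z" for U S
  proof
    assume "near Q D U S"
    then have "gdist ?O U S \<le> enat D" unfolding gdist_le_iff .
    moreover have "gdist_sets ?O {U} Z \<le> gdist ?O U S"
      unfolding gdist_sets_def using that(2) by (auto intro: INF_lower)
    ultimately show False using that(1) by (meson order_trans)
  qed
  show "gdist_sets ?O {X} Z \<le> enat D \<or> gdist_sets ?O {Y} Z \<le> enat D \<or>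
      (\<exists>C\<in>components (delete ?O Z). X \<in> C \<and> Y \<in> C)"
  proof (rule ccontr)
    assume neg: "\<not> ?thesis"
    have "\<forall>S\<in>Z. \<not> near Q D X S" "\<forall>S\<in>Z. \<not> near Q D Y S" using far neg by blast+
    then have link: "(X, Y) \<in> (restr Q (- Z))\<^sup>*" and XZ: "X \<notin> Z"
      using assms[OF _ dZ X Y] Z by auto
    have "restr Q (- Z) = adj (delete ?O Z)"
      using Q_sub unfolding delete_def induced_def by auto
    then have "(X, Y) \<in> (adj (delete ?O Z))\<^sup>*" using link by simp
    moreover have "X \<in> verts (delete ?O Z)" using X XZ unfolding delete_def induced_def by simp
    ultimately show False using neg unfolding components_def by blast
  qed
qed

end

section \<open>Lobes\<close>

context cgraph
begin

text \<open>A lobe is what a separator of diameter at most \<open>d\<close> cuts off from the anchor \<open>Z\<close>, if the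
  separator stays far enough from \<open>Z\<close> to leave it in one component.\<close>

definition lobe :: "nat \<Rightarrow> 'a set \<Rightarrow> 'a set \<Rightarrow> bool" where
  "lobe d Z C \<longleftrightarrow> C \<noteq> {} \<and> C \<subseteq> V \<and> conn E C \<and> C \<inter> Z = {} \<and> diam_le E d (nbr E C) \<and>
     nbr E C \<inter> ball E Z (d div 2) = {}"

definition max_lobe :: "nat \<Rightarrow> 'a set \<Rightarrow> 'a set \<Rightarrow> bool" where
  "max_lobe d Z C \<longleftrightarrow> lobe d Z C \<and> (\<forall>C'. lobe d Z C' \<longrightarrow> C \<subseteq> C' \<longrightarrow> C' = C)"

lemma conn_union:
  assumes "conn E C" "conn E C'" "y \<in> C" "y \<in> nbr E C'"
  shows "conn E (C \<union> C')"
proof -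
  obtain c where c: "c \<in> C'" "(c, y) \<in> E" using assms(4) unfolding nbr_def by blast
  have sy: "sym (restr E (C \<union> C'))" using E_sym by (rule sym_restr)
  have y: "(y, v) \<in> (restr E (C \<union> C'))\<^sup>*" if "v \<in> C \<union> C'" for v
  proof (cases "v \<in> C")
    case True
    then have "(y, v) \<in> (restr E C)\<^sup>*" using assms(1,3) unfolding conn_def by blast
    then show ?thesis by (rule restr_rtrancl_mono[rotated]) simp
  next
    case False
    then have "(c, v) \<in> (restr E C')\<^sup>*" using assms(2) that c(1) unfolding conn_def by blast
    then have "(c, v) \<in> (restr E (C \<union> C'))\<^sup>*" by (rule restr_rtrancl_mono[rotated]) simp
    moreover have "(y, c) \<in> restr E (C \<union> C')" using symD[OF E_sym c(2)] c(1) assms(3) by blast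
    ultimately show ?thesis by (rule converse_rtrancl_into_rtrancl[rotated])
  qed
  show ?thesis
    unfolding conn_def using y rtrancl_symD[OF sy] by (meson rtrancl_trans)
qed

text \<open>The boundary of the union of a chain consists of vertices that are in the boundary of all
  sufficiently large members, so its diameter does not grow.\<close>

lemma lobe_chain:
  assumes ch: "\<And>C. C \<in> \<C> \<Longrightarrow> lobe d Z C" "\<C> \<noteq> {}" "\<And>C C'. C \<in> \<C> \<Longrightarrow> C' \<in> \<C> \<Longrightarrow> C \<subseteq> C' \<or> C' \<subseteq> C"
  shows "lobe d Z (\<Union>\<C>)"
proof -
  have two: "\<exists>C\<in>\<C>. u \<in> C \<and> v \<in> C" if "u \<in> \<Union>\<C>" "v \<in> \<Union>\<C>" for u v
    using that ch(3) by blast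
  have nb: "\<exists>c\<in>\<Union>\<C>. (c, v) \<in> E \<and> v \<notin> \<Union>\<C>" if "v \<in> nbr E (\<Union>\<C>)" for v
    using that unfolding nbr_def by blast
  have nbC: "v \<in> nbr E C" if "v \<notin> \<Union>\<C>" "c \<in> C" "(c, v) \<in> E" "C \<in> \<C>" for v c C
    using that unfolding nbr_def by blast
  have "conn E (\<Union>\<C>)"
    unfolding conn_def
  proof (intro ballI)
    fix u v assume "u \<in> \<Union>\<C>" "v \<in> \<Union>\<C>"
    then obtain C where C: "C \<in> \<C>" "u \<in> C" "v \<in> C" using two by meson
    then have "(u, v) \<in> (restr E C)\<^sup>*" using ch(1) unfolding lobe_def conn_def by blast
    then show "(u, v) \<in> (restr E (\<Union>\<C>))\<^sup>*" by (rule restr_rtrancl_mono[rotated]) (use C(1) in blast)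
  qed
  moreover have "diam_le E d (nbr E (\<Union>\<C>))"
    unfolding diam_le_def
  proof (intro ballI)
    fix u v assume "u \<in> nbr E (\<Union>\<C>)" "v \<in> nbr E (\<Union>\<C>)"
    then obtain c c' where c: "c \<in> \<Union>\<C>" "(c, u) \<in> E" "u \<notin> \<Union>\<C>" "c' \<in> \<Union>\<C>" "(c', v) \<in> E" "v \<notin> \<Union>\<C>"
      using nb by meson
    then obtain C where C: "C \<in> \<C>" "c \<in> C" "c' \<in> C" using two by meson
    then have "u \<in> nbr E C" "v \<in> nbr E C" using nbC c by blast+
    then show "near E d u v" using ch(1)[OF C(1)] unfolding lobe_def diam_le_def by blast
  qed
  moreover have "nbr E (\<Union>\<C>) \<inter> ball E Z (d div 2) = {}"
  proof -
    have "v \<notin> ball E Z (d div 2)" if v: "v \<in> nbr E (\<Union>\<C>)" for v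
    proof -
      obtain c C where "c \<in> C" "(c, v) \<in> E" "v \<notin> \<Union>\<C>" "C \<in> \<C>" using nb[OF v] by blast
      then show ?thesis using nbC ch(1) unfolding lobe_def by blast
    qed
    then show ?thesis by blast
  qed
  ultimately show ?thesis using ch(1,2) unfolding lobe_def by blast
qed

lemma max_lobe_above:
  assumes "lobe d Z C" obtains C' where "max_lobe d Z C'" "C \<subseteq> C'"
proof -
  let ?A = "{D. lobe d Z D \<and> C \<subseteq> D}"
  have "\<exists>M\<in>?A. \<forall>X\<in>?A. M \<subseteq> X \<longrightarrow> X = M"
  proof (rule subset_Zorn_nonempty)
    show "?A \<noteq> {}" using assms by blast
    fix \<C> assume c: "\<C> \<noteq> {}" "subset.chain ?A \<C>"
    then have "lobe d Z (\<Union>\<C>)" by (intro lobe_chain) (auto simp: subset_chain_def)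
    moreover have "C \<subseteq> \<Union>\<C>" using c unfolding subset_chain_def by blast
    ultimately show "\<Union>\<C> \<in> ?A" by blast
  qed
  then obtain M where M: "lobe d Z M" "C \<subseteq> M" "\<forall>X\<in>?A. M \<subseteq> X \<longrightarrow> X = M" by blast
  then have "max_lobe d Z M" unfolding max_lobe_def by blast
  with M(2) that show thesis by blast
qed

text \<open>Maximal lobes can cross only close to their boundaries. If \<open>y\<close> were farther than \<open>d\<close> from
  \<open>N(C)\<close>, then \<open>N(C')\<close>, having diameter at most \<open>d\<close>, would lie in \<open>C\<close> entirely; then
  \<open>N(C \<union> C') \<subseteq> N(C)\<close>, so \<open>C \<union> C'\<close> would be a lobe, and maximality of both would
  give \<open>C = C'\<close>.\<close>

lemma max_lobe_cross:
  assumes C: "max_lobe d Z C" and C': "max_lobe d Z C'" and y: "y \<in> C" "y \<in> nbr E C'"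
  shows "y \<in> ball E (nbr E C) d"
proof (rule ccontr)
  assume far: "y \<notin> ball E (nbr E C) d"
  have "nbr E C' \<subseteq> C"
  proof
    fix z assume z: "z \<in> nbr E C'"
    show "z \<in> C"
    proof (rule ccontr)
      assume "z \<notin> C"
      have "near E d y z" using C' y(2) z unfolding max_lobe_def lobe_def diam_le_def by blast
      then obtain w i j where w: "w \<in> nbr E C" "Suc i + j \<le> d" "near E (Suc i) y w"
        using near_exit[OF _ y(1) \<open>z \<notin> C\<close>] by metis
      then have "near E d w y" using near_mono[OF near_sym[OF E_sym w(3)], of d] by simp
      then show False using far w(1) by (auto intro: in_ballI)
    qed
  qed
  then have n: "nbr E (C \<union> C') \<subseteq> nbr E C" unfolding nbr_def by blast
  have "conn E (C \<union> C')"
    using conn_union[OF _ _ y] C C' unfolding max_lobe_def lobe_def by simp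
  moreover have "lobe d Z C" "lobe d Z C'" using C C' unfolding max_lobe_def by blast+
  moreover from this have "diam_le E d (nbr E (C \<union> C'))"
    using n unfolding lobe_def diam_le_def by (meson subsetD)
  ultimately have "lobe d Z (C \<union> C')" using n unfolding lobe_def by auto
  then have "C \<union> C' = C" "C \<union> C' = C'"
    using C C' Un_upper1[of C C'] Un_upper2[of C' C] unfolding max_lobe_def by metis+
  then have "C = C'" by simp
  then show False using y nbr_disjoint[of E C'] by blast
qed

text \<open>A path from \<open>y\<close> to the anchor leaves the lobe through its boundary, and the part of the path
  after that has length more than \<open>d/2\<close>.\<close>

lemma max_lobe_shallow:
  assumes C: "max_lobe d Z C" and y: "y \<in> C" "y \<in> ball E Z (d + d div 2 + 1)"
  shows "y \<in> ball E (nbr E C) d"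
proof -
  obtain a where a: "a \<in> Z" "near E (d + d div 2 + 1) a y" using y(2) by (rule in_ballE)
  have "a \<notin> C" using a(1) C unfolding max_lobe_def lobe_def by blast
  then obtain w i j where w: "w \<in> nbr E C" "Suc i + j \<le> d + d div 2 + 1" "near E (Suc i) y w" "near E j w a"
    using near_exit[OF near_sym[OF E_sym a(2)] y(1)] by metis
  have "w \<notin> ball E Z (d div 2)" using w(1) C unfolding max_lobe_def lobe_def by blast
  then have "\<not> near E (d div 2) w a" using a(1) near_sym[OF E_sym] in_ballI by metis
  then have "d div 2 < j" using near_mono[OF w(4)] by (meson not_le)
  then have "near E d w y" using near_mono[OF near_sym[OF E_sym w(3)], of d] w(2) by simp
  then show ?thesis using w(1) by (auto intro: in_ballI)
qed

definition rims :: "nat \<Rightarrow> 'a set \<Rightarrow> 'a set" where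
  "rims d Z = (\<Union>C\<in>Collect (max_lobe d Z). nbr E C)"

text \<open>Only components inside a lobe are split off; the remaining ones, whose boundary may be large,
  stay in the bag.\<close>

definition pieces :: "nat \<Rightarrow> 'a set \<Rightarrow> 'a set \<Rightarrow> 'a set set" where
  "pieces d Z A = {B \<in> comps E (A - rims d Z). \<exists>C. max_lobe d Z C \<and> B \<subseteq> C}"

text \<open>A boundary vertex of a piece comes from \<open>N(A)\<close>, hence is near the anchor, or from the
  boundary of another maximal lobe. In both cases, if it is inside \<open>C\<close>, it is within \<open>d\<close> of \<open>N(C)\<close>. So the
  anchor can be moved to \<open>N(C)\<close>, and the diameters of boundaries stay bounded.\<close>

lemma piece_boundary:
  assumes A: "nbr E A \<subseteq> ball E Z (d + d div 2 + 1)"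
    and B: "B \<in> comps E (A - rims d Z)" and C: "max_lobe d Z C" "B \<subseteq> C"
  shows "nbr E B \<subseteq> ball E (nbr E C) d"
proof
  fix y assume y: "y \<in> nbr E B"
  have "y \<in> C \<or> y \<in> nbr E C" using nbr_mono[OF C(2)] y by blast
  then show "y \<in> ball E (nbr E C) d"
  proof
    assume "y \<in> nbr E C" then show ?thesis using subset_ball[of "nbr E C" E d] by blast
  next
    assume yC: "y \<in> C"
    from y comps_nbr_sub[OF B] have "y \<in> nbr E A \<or> y \<in> rims d Z" by blast
    then show ?thesis
      using max_lobe_shallow[OF C(1) yC] max_lobe_cross[OF C(1) _ yC] A unfolding rims_def by blast
  qed
qed

end

section \<open>Inseparability of the torsos\<close>

context torso
begin

text \<open>Every vertex of the torso is close to \<open>S\<close>. A separator that meets the ball of radius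
  \<open>d/2\<close> around \<open>S\<close> is therefore close to everything, and any other separator leaves \<open>S\<close>, and with it
  everything that is far from the separator, in one component.\<close>

lemma small_bag_inseparable:
  assumes S: "S \<noteq> {}" "S \<subseteq> V" "diam_le E d S" and W: "W \<subseteq> ball E S m"
    and D: "Suc m + d + d div 2 \<le> D"
  shows "inseparable_graph d D (outer_torso G W)"
proof (rule inseparableI)
  fix Z X Y assume Z: "Z \<subseteq> VQ" and X: "X \<in> VQ" "\<forall>S\<in>Z. \<not> near Q D X S"
    and Y: "Y \<in> VQ" "\<forall>S\<in>Z. \<not> near Q D Y S"
  have close: "\<exists>s\<in>S. near Q (Suc m) U (branch s)" if U: "U \<in> VQ" for U
  proof -
    obtain v where v: "v \<in> W" "near Q (Suc 0) U (branch v)" using touches_bag[OF U] .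
    obtain s where s: "s \<in> S" "near E m s v" using W v(1) by (meson in_ballE subsetD)
    have "near Q (Suc 0 + m) U (branch s)"
      using near_trans[OF v(2) branch_near[OF near_sym[OF E_sym s(2)]]] .
    then show ?thesis using s(1) by auto
  qed
  obtain s where s: "s \<in> S" "near Q (Suc m) X (branch s)" using close[OF X(1)] by blast
  obtain t where t: "t \<in> S" "near Q (Suc m) Y (branch t)" using close[OF Y(1)] by blast
  have "ball E S (d div 2) \<subseteq> {v. branch v \<notin> Z}"
  proof
    fix v assume "v \<in> ball E S (d div 2)"
    then obtain u where u: "u \<in> S" "near E (d div 2) u v" by (rule in_ballE)
    have "near E d s u" using S(3) s(1) u(1) unfolding diam_le_def by blast
    then have "near E (d + d div 2) s v" using u(2) by (rule near_trans)
    then have "near Q (Suc m + (d + d div 2)) X (branch v)" using near_trans[OF s(2) branch_near] by blast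
    then have "near Q D X (branch v)" by (rule near_mono) (use D in simp)
    then show "v \<in> {v. branch v \<notin> Z}" using X(2) by blast
  qed
  then have "(s, t) \<in> (restr E {v. branch v \<notin> Z})\<^sup>*" by (rule linked_in_ball[OF E_sym S(3) _ s(1) t(1)])
  then have "(branch s, branch t) \<in> (restr Q (- Z))\<^sup>*" by (rule branch_linked) simp
  moreover have far: "\<forall>S\<in>Z. \<not> near Q (Suc m) U S" if "\<forall>S\<in>Z. \<not> near Q D U S" for U
    using that near_mono[of Q "Suc m" U _ D] D by auto
  have "(X, branch s) \<in> (restr Q (- Z))\<^sup>*" "(Y, branch t) \<in> (restr Q (- Z))\<^sup>*"
    using near_avoiding[OF s(2) far[OF X(2)]] near_avoiding[OF t(2) far[OF Y(2)]] by blast+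
  ultimately show "(X, Y) \<in> (restr Q (- Z))\<^sup>*"
    using rtrancl_symD[OF sym_restr[OF Q_sym]] by (meson rtrancl_trans)
qed

text \<open>A bag vertex inside the maximal lobe \<open>C\<close> is near the boundary of \<open>A\<close>, on the boundary of another
  maximal lobe, or in a piece and then near the boundary of that piece. The vertex of that boundary near it is outside \<open>C\<close> or
  within \<open>d\<close> of the boundary of \<open>C\<close>.\<close>

lemma leave_max_lobe:
  assumes A: "nbr E A \<subseteq> ball E Z (d + d div 2 + 1)" and W: "W - A \<subseteq> ball E (nbr E A) r"
    and K: "\<And>B. B \<in> pieces d Z A \<Longrightarrow> B \<inter> W \<subseteq> ball E (nbr E B) r"
    and C: "max_lobe d Z C" and v: "v \<in> W"
  obtains w where "w \<notin> C" "near E (r + d) v w"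
proof (cases "v \<in> C")
  case False
  then show ?thesis using that by auto
next
  case True
  note leaves = that
  have enough: thesis if "v \<in> ball E (nbr E C) k" "k \<le> r + d" for k
  proof -
    obtain w where w: "w \<in> nbr E C" "near E k w v" using \<open>v \<in> ball E (nbr E C) k\<close> by (rule in_ballE)
    then have "near E (r + d) v w" using near_mono[OF near_sym[OF E_sym w(2)]] \<open>k \<le> r + d\<close> by blast
    moreover have "w \<notin> C" using w(1) nbr_disjoint[of E C] by blast
    ultimately show thesis using leaves by blast
  qed
  consider "v \<notin> A" | "v \<in> rims d Z" | "v \<in> A - rims d Z" by blast
  then show thesis
  proof cases
    case 1
    then obtain y where y: "y \<in> nbr E A" "near E r y v" using W v by (meson DiffI in_ballE subsetD)
    show thesis
    proof (cases "y \<in> C")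
      case True
      then have "y \<in> ball E (nbr E C) d" using max_lobe_shallow[OF C] A y(1) by blast
      then show thesis using enough[of "d + r"] ball_near[OF _ y(2)] by simp
    next
      case False
      then show thesis using that near_mono[OF near_sym[OF E_sym y(2)]] by (meson le_add1)
    qed
  next
    case 2
    then show thesis using enough[of d] max_lobe_cross[OF C _ True] unfolding rims_def by auto
  next
    case 3
    then obtain B where B: "B \<in> comps E (A - rims d Z)" "v \<in> B" using comps_cover by metis
    have "nbr E C \<subseteq> rims d Z" using C unfolding rims_def by blast
    then have BC: "B \<subseteq> C"
      using conn_inside[OF comps_conn[OF E_sym B(1)], of C] comps_sub[OF B(1)] B(2) True by blast
    then have "v \<in> ball E (nbr E B) r" using K[of B] B C v unfolding pieces_def by blast
    moreover have "ball E (nbr E B) r \<subseteq> ball E (nbr E C) (d + r)"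
      using ball_mono[OF piece_boundary[OF A B(1) C BC] order_refl, of E r] ball_ball[of E "nbr E C" d r] by (rule order_trans)
    ultimately show thesis using enough[of "d + r"] by auto
  qed
qed

text \<open>A separator that reaches deep into the wing of a piece \<open>B\<close> stays away from the boundary
  of \<open>B\<close> and from the geodesics of \<open>P\<close> that connect this boundary (in the application, \<open>P\<close> is the boundary of a
  lobe). Everything far from the separator is linked to the boundary of \<open>B\<close>: from inside \<open>B\<close> by a path of
  length at most \<open>r + 1\<close>, from outside by a path that avoids \<open>B\<close>.\<close>

lemma deep_separator_harmless:
  assumes B: "B \<in> comps E A'" "B \<subseteq> V" and S: "nbr E B \<subseteq> ball E P d" "diam_le E d P"
    and r: "r = 4 * d + 2" "ball E (nbr E B) r \<subseteq> W" "B \<inter> W \<subseteq> ball E (nbr E B) r"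
    and Z: "diam_le Q d Z" "X0 \<in> Z" "X0 \<subseteq> B - ball E (nbr E B) (r - d)"
    and far: "X \<in> VQ" "\<forall>S\<in>Z. \<not> near Q (Suc r) X S" "Y \<in> VQ" "\<forall>S\<in>Z. \<not> near Q (Suc r) Y S"
  shows "(X, Y) \<in> (restr Q (- Z))\<^sup>*"
proof -
  let ?U = "{v. branch v \<notin> Z}"
  have deep: "U \<subseteq> B - ball E (nbr E B) (2 * d + 2)" if "U \<in> Z" for U
  proof (rule deep_near)
    show "near Q d X0 U" using Z(1,2) that unfolding diam_le_def by blast
    have "r - d = 2 * d + 2 + d" using r(1) by simp
    then show "X0 \<subseteq> B - ball E (nbr E B) (2 * d + 2 + d)" using Z(3) by simp
    show "2 * d + 2 + d \<le> r" using r(1) by simp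
  qed (use r in auto)
  have outside: "w \<in> ?U" if "w \<notin> B \<or> w \<in> ball E (nbr E B) (2 * d + 2)" for w
    using deep[of "branch w"] in_branch[of w] that by blast
  have sy: "sym (restr Q (- Z))" using Q_sym by (rule sym_restr)
  have symU: "sym (restr E ?U)" using E_sym by (rule sym_restr)
  have to_P: "\<exists>p\<in>P. (s, p) \<in> (restr E ?U)\<^sup>* \<and> near E d s p" if "s \<in> nbr E B" for s
  proof -
    obtain p where p: "p \<in> P" "near E d p s" using S(1) \<open>s \<in> nbr E B\<close> by (meson in_ballE subsetD)
    have sp: "near E d s p" using near_sym[OF E_sym p(2)] .
    have "near (restr E ?U) d s p"
    proof (rule near_inside[OF sp])
      fix i j w assume "i + j \<le> d" "near E i s w"
      then show "w \<in> ?U" using outside in_ballI[OF \<open>s \<in> nbr E B\<close>] near_mono[of E i s w "2 * d + 2"] by simp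
    qed
    then have "(s, p) \<in> (restr E ?U)\<^sup>*" by (rule near_imp_rtrancl)
    then show ?thesis using p(1) sp by blast
  qed
  have boundary: "(s, t) \<in> (restr E ?U)\<^sup>*" if st: "s \<in> nbr E B" "t \<in> nbr E B" for s t
  proof -
    obtain p where p: "p \<in> P" "(s, p) \<in> (restr E ?U)\<^sup>*" "near E d s p" using to_P[OF st(1)] by blast
    obtain q where q: "q \<in> P" "(t, q) \<in> (restr E ?U)\<^sup>*" using to_P[OF st(2)] by blast
    have "near E d p q" using S(2) p(1) q(1) unfolding diam_le_def by blast
    then have "near (restr E ?U) d p q"
    proof (rule near_inside)
      fix i j w assume w: "i + j \<le> d" "near E i p w"
      have "near E (2 * d + 2) s w" using near_mono[OF near_trans[OF p(3) w(2)]] w(1) by simp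
      then show "w \<in> ?U" using outside in_ballI[OF st(1)] by blast
    qed
    then have "(p, q) \<in> (restr E ?U)\<^sup>*" by (rule near_imp_rtrancl)
    then show ?thesis using p(2) rtrancl_symD[OF symU q(2)] by (meson rtrancl_trans)
  qed
  have reach_nbr: "\<exists>s\<in>nbr E B. (U, branch s) \<in> (restr Q (- Z))\<^sup>*"
    if U: "U \<in> VQ" "\<forall>S\<in>Z. \<not> near Q (Suc r) U S" for U
  proof -
    obtain v where v: "v \<in> W" "near Q (Suc 0) U (branch v)" using touches_bag[OF U(1)] .
    show ?thesis
    proof (cases "v \<in> ball E (nbr E B) r")
      case True
      then obtain s where s: "s \<in> nbr E B" "near E r s v" by (rule in_ballE)
      have "near Q (Suc 0 + r) U (branch s)" using near_trans[OF v(2) branch_near[OF near_sym[OF E_sym s(2)]]] .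
      then show ?thesis using near_avoiding U(2) s(1) by (metis add_Suc add_0)
    next
      case False
      then have "v \<notin> B" using v(1) r(3) by blast
      then obtain s where s: "s \<in> nbr E B" "(v, s) \<in> (restr E (- B))\<^sup>*"
        using reach_boundary[of v B] v(1) W_sub comps_nonempty[OF B(1)] B(2) by blast
      have "(v, s) \<in> (restr E ?U)\<^sup>*" using restr_rtrancl_mono[OF _ s(2), of ?U] outside by blast
      then have "(branch v, branch s) \<in> (restr Q (- Z))\<^sup>*" by (rule branch_linked) simp
      moreover have "(U, branch v) \<in> (restr Q (- Z))\<^sup>*"
        using near_avoiding[OF near_mono[OF v(2)] U(2)] by simp
      ultimately show ?thesis using s(1) by (meson rtrancl_trans)
    qed
  qed
  obtain s where s: "s \<in> nbr E B" "(X, branch s) \<in> (restr Q (- Z))\<^sup>*" using reach_nbr[OF far(1,2)] by blast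
  obtain t where t: "t \<in> nbr E B" "(Y, branch t) \<in> (restr Q (- Z))\<^sup>*" using reach_nbr[OF far(3,4)] by blast
  have "(branch s, branch t) \<in> (restr Q (- Z))\<^sup>*"
    using branch_linked[OF boundary[OF s(1) t(1)]] by blast
  then show ?thesis using s(2) rtrancl_symD[OF sy t(2)] by (meson rtrancl_trans)
qed

text \<open>The separator \<open>Z\<close> is treated in three cases. If it misses \<open>A\<close>, then \<open>A\<close> links everything;
  if it reaches deep into a piece, \<open>deep_separator_harmless\<close> applies; otherwise it contains no contracted
  vertex and is not near any, so it is a set of diameter at most \<open>d\<close> in the graph and cuts off a
  lobe.\<close>

lemma lobe_bag_inseparable:
  assumes S: "S \<noteq> {}" "S \<subseteq> V" "diam_le E d S"
    and A: "A \<subseteq> V" "A \<inter> ball E S (d + d div 2 + 1) = {}" "nbr E A \<subseteq> ball E S (d + d div 2 + 1)"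
    and r: "r = 4 * d + 2"
    and W: "ball E (nbr E A) r \<subseteq> W" "W - A \<subseteq> ball E (nbr E A) r"
    and K: "\<And>B. B \<in> pieces d S A \<Longrightarrow> ball E (nbr E B) r \<subseteq> W \<and> B \<inter> W \<subseteq> ball E (nbr E B) r"
    and cover: "V - W \<subseteq> (V - (A \<union> nbr E A)) \<union> \<Union>(pieces d S A)"
    and A_conn: "conn E A" and D: "5 * d + 3 \<le> D"
  shows "inseparable_graph d D (outer_torso G W)"
proof (rule inseparableI)
  fix Z X Y assume Z: "Z \<subseteq> VQ" "diam_le Q d Z" and X: "X \<in> VQ" "\<forall>S\<in>Z. \<not> near Q D X S"
    and Y: "Y \<in> VQ" "\<forall>S\<in>Z. \<not> near Q D Y S"
  have sy: "sym (restr Q (- Z))" using Q_sym by (rule sym_restr)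
  have far: "\<forall>S\<in>Z. \<not> near Q k U S" if "\<forall>S\<in>Z. \<not> near Q D U S" "k \<le> D" for U k
    using that near_mono[of Q k U _ D] by auto
  consider (miss) "\<forall>a\<in>A. branch a \<notin> Z"
    | (deep) B X0 where "B \<in> pieces d S A" "X0 \<in> Z" "X0 \<subseteq> B - ball E (nbr E B) (r - d)"
    | (real) a where "a \<in> A" "branch a \<in> Z"
      "\<And>B X0. B \<in> pieces d S A \<Longrightarrow> X0 \<in> Z \<Longrightarrow> \<not> X0 \<subseteq> B - ball E (nbr E B) (r - d)" by blast
  then show "(X, Y) \<in> (restr Q (- Z))\<^sup>*"
  proof cases
    case miss
    have to_A: "\<exists>a\<in>A. (U, branch a) \<in> (restr Q (- Z))\<^sup>*"
      if U: "U \<in> VQ" "\<forall>S\<in>Z. \<not> near Q D U S" for U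
    proof -
      obtain v where v: "v \<in> W" "near Q (Suc 0) U (branch v)" using touches_bag[OF U(1)] .
      show ?thesis
      proof (cases "v \<in> A")
        case True
        have "(U, branch v) \<in> (restr Q (- Z))\<^sup>*" using near_avoiding[OF v(2)] far[OF U(2)] D by simp
        then show ?thesis using True by blast
      next
        case False
        then obtain y where y: "y \<in> nbr E A" "near E r y v" using W(2) v(1) by (meson DiffI in_ballE subsetD)
        have n: "near Q (Suc 0 + r) U (branch y)" using near_trans[OF v(2) branch_near[OF near_sym[OF E_sym y(2)]]] .
        have le: "Suc 0 + r \<le> D" using D r by simp
        have "(U, branch y) \<in> (restr Q (- Z))\<^sup>*" using near_avoiding[OF n far[OF U(2) le]] .
        moreover have yZ: "branch y \<notin> Z" using n far[OF U(2) le] by blast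
        obtain a where a: "a \<in> A" "(a, y) \<in> E" using y(1) unfolding nbr_def by blast
        have "(y, a) \<in> (restr E {v. branch v \<notin> Z})\<^sup>*"
          using symD[OF E_sym a(2)] yZ miss a(1) by (intro r_into_rtrancl) blast
        then have "(branch y, branch a) \<in> (restr Q (- Z))\<^sup>*" by (rule branch_linked) simp
        ultimately show ?thesis using a(1) by (meson rtrancl_trans)
      qed
    qed
    obtain a where a: "a \<in> A" "(X, branch a) \<in> (restr Q (- Z))\<^sup>*" using to_A[OF X] by blast
    obtain b where b: "b \<in> A" "(Y, branch b) \<in> (restr Q (- Z))\<^sup>*" using to_A[OF Y] by blast
    have "(a, b) \<in> (restr E A)\<^sup>*" using A_conn a(1) b(1) unfolding conn_def by blast
    then have "(branch a, branch b) \<in> (restr Q (- Z))\<^sup>*" by (rule branch_linked) (use miss in blast)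
    then show ?thesis using a(2) rtrancl_symD[OF sy b(2)] by (meson rtrancl_trans)
  next
    case deep
    obtain C where C: "B \<in> comps E (A - rims d S)" "max_lobe d S C" "B \<subseteq> C"
      using deep(1) unfolding pieces_def by blast
    have "diam_le E d (nbr E C)" using C(2) unfolding max_lobe_def lobe_def by blast
    moreover have "B \<subseteq> V" using comps_sub[OF C(1)] A(1) by blast
    moreover have "Suc r \<le> D" using r D by simp
    ultimately show ?thesis
      using deep_separator_harmless[OF C(1) _ piece_boundary[OF A(3) C] _ r _ _ Z(2) deep(2,3) X(1) _ Y(1)]
        K[OF deep(1)] far X(2) Y(2) by blast
  next
    case real
    \<comment> \<open>A contracted vertex within \<open>d\<close> of the separator would lie in a wing at depth \<open>r\<close>. For the wing of a
      piece this was excluded; the wing outside \<open>A\<close> is excluded by the vertex \<open>a\<close> of the separator,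
      which is at distance at most \<open>2d\<close> and lies in \<open>A\<close>.\<close>
    have single: "\<exists>y\<in>W. U = {y}" if U: "U \<in> VQ" "X0 \<in> Z" "near Q d X0 U" for U X0
    proof (rule ccontr)
      assume no: "\<not> (\<exists>y\<in>W. U = {y})"
      then have Uc: "U \<in> comps E (V - W)" using U(1) by (blast elim: VQ_cases)
      then obtain y where y: "y \<in> U" using comps_nonempty by blast
      then have yW: "y \<in> V" "y \<notin> W" using comps_sub[OF Uc] by auto
      have sU: "near Q d U X0" using near_sym[OF Q_sym U(3)] .
      from cover yW consider "y \<in> V - (A \<union> nbr E A)" | B where "B \<in> pieces d S A" "y \<in> B" by blast
      then show False
      proof cases
        case 1
        let ?B = "V - (A \<union> nbr E A)"
        have nB: "nbr E ?B \<subseteq> nbr E A"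
        proof
          fix z assume "z \<in> nbr E ?B"
          then obtain b where b: "b \<in> ?B" "(b, z) \<in> E" "z \<notin> ?B" unfolding nbr_def by blast
          have "z \<notin> A" using symD[OF E_sym b(2)] b(1) unfolding nbr_def by blast
          then show "z \<in> nbr E A" using b E_sub by blast
        qed
        have "U \<subseteq> ?B - ball E (nbr E A) r" using contracted_in_wing[OF U(1) y yW(2) 1 nB W(1)] .
        moreover have "near Q (d + d) U (branch a)"
          using near_trans[OF sU] Z(2) U(2) real(2) unfolding diam_le_def by blast
        ultimately have "branch a \<subseteq> ?B - ball E (nbr E A) (r - (d + d))"
          using deep_near[of "d + d" U "branch a" ?B "nbr E A" "r - (d + d)" r, OF _ _ _ nB W(1)] r by simp
        then show False using in_branch[of a] real(1) by blast
      next
        case 2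
        note KB = K[OF 2(1)]
        have "U \<subseteq> B - ball E (nbr E B) r"
          using contracted_in_wing[OF U(1) y yW(2) 2(2) order_refl] KB by blast
        then have "X0 \<subseteq> B - ball E (nbr E B) (r - d)"
          using deep_near[of d U X0 B "nbr E B" "r - d" r, OF sU] KB r by simp
        then show False using real(3)[OF 2(1) U(2)] by blast
      qed
    qed
    define Zg where "Zg = {v. branch v \<in> Z}"
    have Zg: "{z} \<in> Z" "z \<in> W" if "z \<in> Zg" for z
    proof -
      have "branch z \<in> Z" using that unfolding Zg_def by blast
      then obtain y where y: "y \<in> W" "branch z = {y}" using single[of "branch z" "branch z"] Z(1) by auto
      then have "y = z" using in_branch[of z] by simp
      then show "{z} \<in> Z" "z \<in> W" using y \<open>branch z \<in> Z\<close> by auto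
    qed
    have diamZg: "near E d z z'" if "z \<in> Zg" "z' \<in> Zg" for z z'
    proof (rule near_lift)
      show "near Q d {z} {z'}" using Z(2) Zg that unfolding diam_le_def by blast
      fix U assume "U \<in> VQ" "near Q d {z} U"
      then show "\<exists>y\<in>W. U = {y}" using single Zg(1)[OF that(1)] by blast
    qed
    have aZ: "a \<in> Zg" using real(2) unfolding Zg_def by simp
    have away: "Zg \<inter> ball E S (d div 2) = {}"
    proof (rule ccontr)
      assume "\<not> ?thesis"
      then obtain z where z: "z \<in> Zg" "z \<in> ball E S (d div 2)" by blast
      have "a \<in> ball E S (d div 2 + d)" using ball_near[OF z(2) diamZg[OF z(1) aZ]] .
      then have "a \<in> ball E S (d + d div 2 + 1)"
        using ball_mono[OF order_refl, of "d div 2 + d" "d + d div 2 + 1" E S] by auto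
      then show False using A(2) real(1) by blast
    qed
    \<comment> \<open>Otherwise the component of \<open>x\<close> is a lobe. Leaving the maximal lobe around it takes at most
      \<open>1 + r + d\<close> steps from \<open>U\<close>, too few to come near the separator.\<close>
    have meets: "\<exists>s\<in>S. (x, s) \<in> (restr E (V - Zg))\<^sup>*"
      if U: "U \<in> VQ" "\<forall>S\<in>Z. \<not> near Q D U S" "x \<in> U" for U x
    proof (rule ccontr)
      assume no: "\<not> ?thesis"
      have UZ: "U \<notin> Z" using U(2) near_refl[of Q D U] by blast
      have x: "x \<in> V - Zg" using VQ_sub[OF U(1)] U(3) UZ branch_eq[OF U(1,3)] unfolding Zg_def by auto
      define C where "C = {v. (x, v) \<in> (restr E (V - Zg))\<^sup>*}"
      have C: "C \<in> comps E (V - Zg)" unfolding C_def comps_def using x by blast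
      have nC: "nbr E C \<subseteq> Zg" using comps_nbr[OF C] nbr_sub[OF E_sub, of C] by blast
      have "lobe d S C"
        unfolding lobe_def
        using comps_nonempty[OF C] comps_sub[OF C] comps_conn[OF E_sym C] no nC away diamZg
        unfolding C_def diam_le_def by blast
      then obtain C' where C': "max_lobe d S C'" "C \<subseteq> C'" by (rule max_lobe_above)
      obtain v where v: "v \<in> W" "near Q (Suc 0) U (branch v)" using touches_bag[OF U(1)] .
      obtain w where w: "w \<notin> C'" "near E (r + d) v w"
        using leave_max_lobe[OF A(3) W(2) _ C'(1) v(1)] K by blast
      have n: "near Q (Suc 0 + (r + d)) U (branch w)" using near_trans[OF v(2) branch_near[OF w(2)]] .
      have "Suc 0 + (r + d) \<le> D" using r D by simp
      then have "(U, branch w) \<in> (restr Q (- Z))\<^sup>*" using near_avoiding[OF n far[OF U(2)]] by blast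
      then have "(x, w) \<in> (restr E {v. branch v \<notin> Z})\<^sup>*"
        using linked_lift[OF _ U(1) UZ U(3)] in_branch by blast
      moreover have "restr E {v. branch v \<notin> Z} = restr E (V - Zg)"
        using E_sub unfolding Zg_def by blast
      ultimately have "w \<in> C" unfolding C_def by simp
      then show False using C'(2) w(1) by blast
    qed
    obtain x y where xy: "x \<in> X" "y \<in> Y" using VQ_nonempty X(1) Y(1) by blast
    obtain s where s: "s \<in> S" "(x, s) \<in> (restr E (V - Zg))\<^sup>*" using meets[OF X xy(1)] by blast
    obtain t where t: "t \<in> S" "(y, t) \<in> (restr E (V - Zg))\<^sup>*" using meets[OF Y xy(2)] by blast
    have "ball E S (d div 2) \<subseteq> V - Zg" using away ball_sub[OF E_sub S(2)] by blast
    then have "(s, t) \<in> (restr E (V - Zg))\<^sup>*" by (rule linked_in_ball[OF E_sym S(3) _ s(1) t(1)])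
    then have "(x, y) \<in> (restr E (V - Zg))\<^sup>*"
      using s(2) rtrancl_symD[OF sym_restr[OF E_sym] t(2)] by (meson rtrancl_trans)
    then have "(branch x, branch y) \<in> (restr Q (- Z))\<^sup>*"
      by (rule branch_linked) (auto simp: Zg_def)
    then show ?thesis using branch_eq[OF X(1) xy(1)] branch_eq[OF Y(1) xy(2)] by simp
  qed
qed

end

section \<open>The layered family\<close>

lemma diam_le_ball:
  assumes "sym E" "diam_le E d Z" "S \<subseteq> ball E Z k" "k + d + k \<le> e"
  shows "diam_le E e S"
  unfolding diam_le_def
proof (intro ballI)
  fix u v assume "u \<in> S" "v \<in> S"
  then have "u \<in> ball E Z k" "v \<in> ball E Z k" using assms(3) by auto
  then obtain x y where x: "x \<in> Z" "near E k x u" and y: "y \<in> Z" "near E k y v" by (meson in_ballE)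
  have "near E d x y" using assms(2) x(1) y(1) unfolding diam_le_def by blast
  then have "near E (k + d + k) u v"
    using near_trans[OF near_trans[OF near_sym[OF assms(1) x(2)]] y(2)] by blast
  then show "near E e u v" using assms(4) by (rule near_mono)
qed

text \<open>The choice of \<open>r\<close> makes it an upper bound for the diameter \<open>d + 2p\<close> of every boundary, while
  \<open>p + r + 1 + d + \<lfloor>d/2\<rfloor> \<le> 7d + 4\<close> still holds, which is what the torsos of even levels need.\<close>

locale splitting = cgraph +
  fixes d :: nat
  assumes V_nonempty: "verts G \<noteq> {}"
begin

abbreviation "p \<equiv> d + d div 2 + 1"
abbreviation "r \<equiv> 4 * d + 2"

text \<open>The situation at even levels: \<open>A\<close> is a piece of a lobe with boundary \<open>Z\<close>, or \<open>A\<close> is the whole vertex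
  set and \<open>Z\<close> is arbitrary.\<close>

definition near_anchor :: "'a set \<Rightarrow> 'a set \<Rightarrow> bool" where
  "near_anchor Z A \<longleftrightarrow> Z \<noteq> {} \<and> Z \<subseteq> V \<and> diam_le E d Z \<and> nbr E A \<subseteq> ball E Z d"

text \<open>The situation at odd levels: \<open>A\<close> is a component of the complement of a ball around
  \<open>Z\<close>.\<close>

definition far_anchor :: "'a set \<Rightarrow> 'a set \<Rightarrow> bool" where
  "far_anchor Z A \<longleftrightarrow> Z \<noteq> {} \<and> Z \<subseteq> V \<and> diam_le E d Z \<and> A \<inter> ball E Z p = {} \<and> nbr E A \<subseteq> ball E Z p"

definition anchor :: "nat \<Rightarrow> 'a set \<Rightarrow> 'a set" where
  "anchor n A = (SOME Z. if even n then near_anchor Z A else far_anchor Z A)"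

definition offspring :: "nat \<Rightarrow> 'a set \<Rightarrow> 'a set set" where
  "offspring n A = (if even n then comps E (A - ball E (anchor n A) p) else pieces d (anchor n A) A)"

primrec F :: "nat \<Rightarrow> 'a set set" where
  "F 0 = {V}"
| "F (Suc n) = (\<Union>A\<in>F n. offspring n A)"

lemma offspring_comps: "\<exists>X. offspring n A \<subseteq> comps E (A - X)"
  unfolding offspring_def pieces_def by (cases "even n") auto

lemma offspring_sub: "B \<in> offspring n A \<Longrightarrow> B \<subseteq> A \<and> B \<noteq> {} \<and> conn E B"
  using offspring_comps[of n A] comps_sub comps_nonempty comps_conn[OF E_sym] by blast

lemma offspring_apart:
  assumes "B \<in> offspring n A" "B' \<in> offspring n A" "B \<noteq> B'" shows "(B \<union> nbr E B) \<inter> B' = {}"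
proof -
  obtain X where "offspring n A \<subseteq> comps E (A - X)" using offspring_comps by blast
  then have B: "B \<in> comps E (A - X)" "B' \<in> comps E (A - X)" using assms by auto
  show ?thesis using comps_disjoint[OF E_sym B assms(3)] comps_nbr[OF B(1)] comps_sub[OF B(2)] by blast
qed

lemma anchored:
  assumes "if even n then \<exists>Z. near_anchor Z A else \<exists>Z. far_anchor Z A"
  shows "even n \<Longrightarrow> near_anchor (anchor n A) A" "odd n \<Longrightarrow> far_anchor (anchor n A) A"
  unfolding anchor_def using assms someI_ex[of "\<lambda>Z. near_anchor Z A"] someI_ex[of "\<lambda>Z. far_anchor Z A"] by simp_all

lemma ball_offspring_boundary:
  assumes "even n" "near_anchor (anchor n A) A" "B \<in> offspring n A"
  shows "far_anchor (anchor n A) B"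
proof -
  have B: "B \<in> comps E (A - ball E (anchor n A) p)" using assms(1,3) unfolding offspring_def by simp
  have "ball E (anchor n A) d \<subseteq> ball E (anchor n A) p" by (rule ball_mono) auto
  then have "nbr E B \<subseteq> ball E (anchor n A) p"
    using assms(2) comps_nbr_sub[OF B] unfolding near_anchor_def by (auto dest!: subsetD)
  moreover have "B \<inter> ball E (anchor n A) p = {}" using comps_sub[OF B] by blast
  ultimately show ?thesis using assms(2) unfolding near_anchor_def far_anchor_def by simp
qed

lemma lobe_offspring_boundary:
  assumes "odd n" "far_anchor (anchor n A) A" "B \<in> offspring n A"
  shows "\<exists>Z. near_anchor Z B"
proof -
  let ?Z = "anchor n A"
  obtain C where B: "B \<in> comps E (A - rims d ?Z)" and C: "max_lobe d ?Z C" "B \<subseteq> C"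
    using assms(1,3) unfolding offspring_def pieces_def by auto
  have lobe: "lobe d ?Z C" using C(1) unfolding max_lobe_def by blast
  obtain z where z: "z \<in> ?Z" "z \<in> V" using assms(2) unfolding far_anchor_def by blast
  have "nbr E C \<noteq> {}" using nbr_nonempty[of z C] z lobe unfolding lobe_def by blast
  moreover have "nbr E B \<subseteq> ball E (nbr E C) d"
    using piece_boundary[OF _ B C] assms(2) unfolding far_anchor_def by blast
  ultimately have "near_anchor (nbr E C) B"
    using lobe nbr_sub[OF E_sub, of C] unfolding near_anchor_def lobe_def by blast
  then show ?thesis by blast
qed

lemma F_invariant:
  "A \<in> F n \<Longrightarrow> A \<subseteq> V \<and> A \<noteq> {} \<and> conn E A \<and>
    (if even n then \<exists>Z. near_anchor Z A else \<exists>Z. far_anchor Z A)"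
proof (induction n arbitrary: A)
  case 0
  obtain v where "v \<in> V" using V_nonempty by blast
  moreover have "nbr E V = {}" using E_sub unfolding nbr_def by blast
  ultimately have "near_anchor {v} V" unfolding near_anchor_def diam_le_def by auto
  moreover have "restr E V = E" using E_sub by blast
  then have "conn E V" using reach unfolding conn_def by simp
  ultimately show ?case using 0 V_nonempty by auto
next
  case (Suc n)
  then obtain A' where A': "A' \<in> F n" "A \<in> offspring n A'" by auto
  note IH = Suc.IH[OF A'(1)]
  note anc = anchored[OF conjunct2[OF conjunct2[OF conjunct2[OF IH]]]]
  have "if even (Suc n) then \<exists>Z. near_anchor Z A else \<exists>Z. far_anchor Z A"
    using ball_offspring_boundary[OF _ anc(1) A'(2)] lobe_offspring_boundary[OF _ anc(2) A'(2)] by auto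
  then show ?case using offspring_sub[OF A'(2)] IH by auto
qed

lemma even_anchor: "A \<in> F n \<Longrightarrow> even n \<Longrightarrow> near_anchor (anchor n A) A"
  using F_invariant[of A n] anchored(1)[of n A] by auto

lemma odd_anchor: "A \<in> F n \<Longrightarrow> odd n \<Longrightarrow> far_anchor (anchor n A) A"
  using F_invariant[of A n] anchored(2)[of n A] by auto

lemma F_par: "B \<in> F (Suc n) \<Longrightarrow> \<exists>A\<in>F n. B \<subseteq> A"
  unfolding F.simps using offspring_sub[of B n] by blast

lemma F_separate: "A \<in> F n \<Longrightarrow> B \<in> F n \<Longrightarrow> A \<noteq> B \<Longrightarrow> (A \<union> nbr E A) \<inter> B = {}"
proof (induction n arbitrary: A B)
  case (Suc n)
  then obtain A' B' where A': "A' \<in> F n" "A \<in> offspring n A'" and B': "B' \<in> F n" "B \<in> offspring n B'" by auto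
  show ?case
  proof (cases "A' = B'")
    case True
    then show ?thesis using offspring_apart A'(2) B'(2) Suc.prems(3) by blast
  next
    case False
    then have "(A' \<union> nbr E A') \<inter> B' = {}" using Suc.IH A'(1) B'(1) by blast
    moreover have "nbr E A \<subseteq> A' \<union> nbr E A'" using nbr_mono offspring_sub[OF A'(2)] by metis
    ultimately show ?thesis using offspring_sub[OF A'(2)] offspring_sub[OF B'(2)] by blast
  qed
qed auto

lemma F_boundary_diam: assumes "A \<in> F n" shows "diam_le E r (nbr E A)"
proof (cases "even n")
  case True
  note Z = even_anchor[OF assms True, unfolded near_anchor_def]
  show ?thesis by (rule diam_le_ball[OF E_sym, of d "anchor n A" _ d]) (use Z in simp_all)
next
  case False
  note Z = odd_anchor[OF assms False, unfolded far_anchor_def]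
  show ?thesis by (rule diam_le_ball[OF E_sym, of d "anchor n A" _ p]) (use Z in simp_all)
qed

definition root :: 'a where
  "root = (SOME v. v \<in> anchor 0 V)"

lemma root: "root \<in> anchor 0 V" "root \<in> V"
proof -
  have Z: "near_anchor (anchor 0 V) V" using even_anchor[of V 0] by simp
  then have "\<exists>v. v \<in> anchor 0 V" unfolding near_anchor_def by blast
  then show "root \<in> anchor 0 V" unfolding root_def by (rule someI_ex)
  then show "root \<in> V" using Z unfolding near_anchor_def by blast
qed

text \<open>The first cut set is a ball around an anchor that contains the root, so the root is lost
  after level \<open>0\<close>. Its distance measures the progress of the construction.\<close>

lemma root_outside: "A \<in> F (Suc n) \<Longrightarrow> root \<notin> A"
proof (induction n arbitrary: A)
  case 0
  then have "A \<subseteq> V - ball E (anchor 0 V) p" using comps_sub[of A] by (auto simp: offspring_def)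
  then show ?case using root(1) subset_ball[of "anchor 0 V" E p] by blast
next
  case (Suc n)
  then show ?case using F_par[OF Suc.prems] by blast
qed

text \<open>At an even level, the children of \<open>A1\<close> are at distance more than \<open>p > d\<close> from the anchor, so they have no
  neighbour in \<open>N(A1)\<close>, which is within \<open>d\<close> of the anchor. Hence a walk from a child to the root crosses the boundary of the
  child at a vertex that still lies in \<open>A1\<close> and is strictly closer to the root. Every
  two levels cost at least one step, and infinite degrees do no harm.\<close>

lemma F_depth: "A \<in> F (Suc (2 * j)) \<Longrightarrow> v \<in> A \<Longrightarrow> near E k v root \<Longrightarrow> j \<le> k"
proof (induction j arbitrary: A v k)
  case (Suc j)
  let ?n = "Suc (Suc (2 * j))"
  have "A \<in> F (Suc ?n)" using Suc.prems(1) by simp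
  then obtain A1 where A1: "A1 \<in> F ?n" "A \<in> offspring ?n A1" by auto
  obtain A2 where A2: "A2 \<in> F (Suc (2 * j))" "A1 \<subseteq> A2" using F_par[OF A1(1)] by blast
  let ?Z = "anchor ?n A1"
  have Z: "near_anchor ?Z A1" using even_anchor[OF A1(1)] by simp
  have far: "A \<inter> ball E ?Z p = {}"
    using ball_offspring_boundary[OF _ Z A1(2)] unfolding far_anchor_def by simp
  obtain w i l where w: "w \<in> nbr E A" "Suc i + l \<le> k" "near E l w root"
    using near_exit[OF Suc.prems(3,2)] root_outside Suc.prems(1) by (metis mult_Suc_right)
  have "w \<notin> nbr E A1"
  proof
    assume "w \<in> nbr E A1"
    then have wZ: "w \<in> ball E ?Z d" using Z unfolding near_anchor_def by blast
    obtain a where a: "a \<in> A" "(a, w) \<in> E" using w(1) unfolding nbr_def by blast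
    have "a \<in> ball E ?Z (d + Suc 0)" using ball_near[OF wZ near_edge[OF symD[OF E_sym a(2)]]] .
    moreover have "ball E ?Z (d + Suc 0) \<subseteq> ball E ?Z p" by (rule ball_mono) auto
    ultimately show False using far a(1) by blast
  qed
  then have "w \<in> A1" using nbr_mono[of A A1 E] offspring_sub[OF A1(2)] w(1) by blast
  then have "j \<le> l" using Suc.IH[OF A2(1) _ w(3)] A2(2) by blast
  then show ?case using w(2) by simp
qed simp

lemma F_leave: assumes "v \<in> V" shows "\<exists>n. v \<notin> \<Union>(F n)"
proof -
  obtain k where k: "near E k v root" using reach_near[OF assms root(2)] .
  have "v \<notin> \<Union>(F (Suc (2 * Suc k)))"
  proof
    assume "v \<in> \<Union>(F (Suc (2 * Suc k)))"
    then obtain A where "A \<in> F (Suc (2 * Suc k))" "v \<in> A" by blast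
    then have "Suc k \<le> k" using k by (rule F_depth)
    then show False by simp
  qed
  then show ?thesis by blast
qed

sublocale layering E V F r
proof
  show "E \<subseteq> V \<times> V" by (rule E_sub)
  show "sym E" by (rule E_sym)
  show "F 0 = {V}" by simp
  show "\<And>B n. B \<in> F (Suc n) \<Longrightarrow> B \<noteq> {}" using F_invariant by blast
qed (fact F_par F_separate F_leave F_boundary_diam)+

lemma kids_offspring: assumes "A \<in> F n" shows "kids n A = offspring n A"
proof
  show "offspring n A \<subseteq> kids n A" using assms offspring_sub unfolding kids_def by auto
  show "kids n A \<subseteq> offspring n A"
  proof
    fix B assume B: "B \<in> kids n A"
    then obtain A' where A': "A' \<in> F n" "B \<in> offspring n A'" unfolding kids_def by auto
    have "A' = A" using F_unique[OF A'(1) assms] offspring_sub[OF A'(2)] kidsD[OF B] by blast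
    then show "B \<in> offspring n A" using A'(2) by simp
  qed
qed

text \<open>Needed for \<open>touches_bag\<close>: a contracted component has a neighbour in the bag only if there is a
  bag vertex at all.\<close>

lemma bag_nonempty: assumes "A \<in> F n" shows "bag (n, A) \<noteq> {}"
proof (cases n)
  case 0
  have "root \<notin> B" if "B \<in> kids 0 V" for B using kidsD[OF that] root_outside by blast
  then have "root \<in> core 0 V" using root(2) unfolding core_def by blast
  then show ?thesis using core_bag[of 0 V] 0 assms by auto
next
  case (Suc m)
  have "nbr E A \<noteq> {}"
    using nbr_nonempty[of root A] root(2) root_outside[of A m] F_invariant[OF assms] assms Suc by blast
  then show ?thesis using nbr_core[of A n] core_bag[of n A] by blast
qed

lemma torso_bag: "A \<in> F n \<Longrightarrow> torso G (bag (n, A))"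
  using bag_sub bag_nonempty by unfold_locales auto

text \<open>Since all components of \<open>A\<close> minus the ball are children, the core lies in the ball.\<close>

lemma even_bag:
  assumes A: "A \<in> F n" and n: "even n"
  shows "bag (n, A) \<subseteq> ball E (anchor n A) (p + r)"
proof -
  let ?Z = "anchor n A"
  note anc = even_anchor[OF A n]
  have K: "kids n A = comps E (A - ball E ?Z p)" using kids_offspring[OF A] n unfolding offspring_def by simp
  have dp: "ball E ?Z d \<subseteq> ball E ?Z p" by (rule ball_mono) auto
  have nA: "nbr E A \<subseteq> ball E ?Z p" using anc dp unfolding near_anchor_def by blast
  have core: "core n A \<subseteq> ball E ?Z p"
    using comps_cover[of _ "A - ball E ?Z p" E] nA unfolding core_def K by blast
  have pr: "ball E ?Z p \<subseteq> ball E ?Z (p + r)" by (rule ball_mono) auto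
  have thick: "ball E S r \<subseteq> ball E ?Z (p + r)" if "S \<subseteq> ball E ?Z p" for S
    using ball_mono[OF that order_refl, of E r] ball_ball[of E ?Z p r] by (rule order_trans)
  have "nbr E B \<subseteq> ball E ?Z p" if "B \<in> kids n A" for B
    using ball_offspring_boundary[OF n anc] that kids_offspring[OF A] unfolding far_anchor_def by blast
  then have "(\<Union>B\<in>kids n A. ball E (nbr E B) r) \<subseteq> ball E ?Z (p + r)"
    using thick by (intro UN_least) blast
  then show ?thesis using core pr thick[OF nA] unfolding bag_def prod.case by blast
qed

lemma bag_inseparable:
  assumes A: "A \<in> F n"
  shows "inseparable_graph d (7 * d + 4) (outer_torso G (bag (n, A)))"
proof -
  interpret torso G "bag (n, A)" using torso_bag[OF A] .
  let ?Z = "anchor n A"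
  show ?thesis
  proof (cases "even n")
    case True
    show ?thesis
      using even_anchor[OF A True] small_bag_inseparable[OF _ _ _ even_bag[OF A True], of d "7 * d + 4"]
      unfolding near_anchor_def by simp
  next
    case False
    note anc = odd_anchor[OF A False, unfolded far_anchor_def]
    have K: "kids n A = pieces d ?Z A" using kids_offspring[OF A] False unfolding offspring_def by simp
    show ?thesis
    proof (rule lobe_bag_inseparable[where S = ?Z and A = A and r = r])
      show "?Z \<noteq> {}" "?Z \<subseteq> V" "diam_le E d ?Z" "A \<inter> ball E ?Z p = {}" "nbr E A \<subseteq> ball E ?Z p"
        using anc by blast+
      show "A \<subseteq> V" "conn E A" using F_invariant[OF A] by blast+
      show "ball E (nbr E A) r \<subseteq> bag (n, A)" by (rule ball_nbr_bag)
      show "bag (n, A) - A \<subseteq> ball E (nbr E A) r"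
        using bag_below_outside[of "(n, A)" "(n, A)"] A unfolding below_def by auto
      show "V - bag (n, A) \<subseteq> V - (A \<union> nbr E A) \<union> \<Union>(pieces d ?Z A)"
        using core_bag[of n A] unfolding core_def K by blast
      fix B assume "B \<in> pieces d ?Z A"
      then have B: "B \<in> kids n A" using K by blast
      then have "(B, nbr E B) \<in> wings n A" unfolding wings_def by blast
      then show "ball E (nbr E B) r \<subseteq> bag (n, A) \<and> B \<inter> bag (n, A) \<subseteq> ball E (nbr E B) r"
        using wing(4,6)[OF A] by blast
    qed auto
  qed
qed

end

theorem theorem1p2:
  fixes G :: "'a ugraph" and d :: nat
  assumes "simple_graph G" and "connected_graph G"
  shows "\<exists>(T :: (nat \<times> 'a set) ugraph) V.
           tree_decomposition G T V \<and>
           (\<forall>(s, t)\<in>adj T. intrinsic_diam G (V s \<inter> V t) \<le> enat (15 * d + 8)) \<and>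
           (\<forall>t\<in>verts T. inseparable_graph d (7 * d + 4) (outer_torso G (V t))) \<and>
           (\<forall>t\<in>verts T. additive_distortion_le (20 * d + 12) (induced G (V t)) G id)"
proof (cases "verts G = {}")
  case False
  then interpret splitting G d using assms by unfold_locales
  have "\<forall>t\<in>verts T. inseparable_graph d (7 * d + 4) (outer_torso G (bag t))"
    using bag_inseparable verts_T by auto
  then show ?thesis using layering_bounds[of G d] by blast
next
  case True
  then have E: "adj G = {}" using assms(1) unfolding simple_graph_def by blast
  \<comment> \<open>The empty graph has no anchor, but the single node with an empty bag is a layering as well.\<close>
  interpret layering "adj G" "verts G" "\<lambda>n. if n = 0 then {verts G} else {}" "4 * d + 2"
    by unfold_locales (auto simp: True E sym_def diam_le_def nbr_def split: if_splits)
  have "inseparable_graph d (7 * d + 4) (outer_torso G (bag t))" if "t \<in> verts T" for t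
  proof -
    have "bag t = {}" using bag_sub[of "snd t" "fst t"] that True verts_T by simp
    then have "verts (outer_torso G (bag t)) = {}"
      using True by (auto simp: outer_torso_def Let_def components_def delete_def induced_def)
    then show ?thesis unfolding inseparable_graph_def inseparable_in_def by simp
  qed
  then show ?thesis using layering_bounds[of G d] by blast
qed

end
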